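(* There is an absolute constant $C$ such that the following holds. Let $X$ be the $5$-partite ($4$-dimensional) Ramanujan clique complex over $\mathbb{F}_q$, with parts $V_0,\dots,V_4$ each of size $n$. Let $\delta<q^{-25/4}$ and let $U\subseteq X(0)$ satisfy $|U|\le\delta n$. Then the number of $4$-dimensional faces ($5$-vertex faces) of $X$ having at least $3$ vertices in $U$ is at most $C\,q^{13/2}\,|U|$.
   Context: Take $k=5$ below. Let $q$ be a prime power and $k,e\ge 2$ integers with $q^e>4k^2+1$. The Ramanujan clique complex $X$ (of Lubotzky--Samuels--Vishne) with these parameters is the $(k-1)$-dimensional clique complex of the Cayley graph of $\Gamma=\mathrm{PGL}_k(\mathbb{F}_{q^e})$ with respect to the symmetric generating set $S=S_1\sqcup\dots\sqcup S_{k-1}$ they construct: its vertex set is $\Gamma$ and its $(k-1)$-faces are the $k$-element sets of pairwise adjacent vertices. $X(t)$ denotes the set of $t$-dimensional faces (sets of $t+1$ vertices); $X(0)$ is the vertex set. Write $\binom{k}{i}_q$ for the Gaussian binomial coefficient. $X$ has the following properties. (1) $X$ is $k$-partite: $X(0)=V_0\sqcup\dots\sqcup V_{k-1}$ with all parts of equal size, denoted $n$, and every $(k-1)$-face has one vertex in each part. (2) For $0<i<k$, $S_i$ creates directed edges from $V_a$ to $V_{a+i}$ (indices mod $k$); the resulting directed graph, with adjacency matrix $A_i$, is out-regular of degree $\binom{k}{i}_q$. (3) $A_1,\dots,A_{k-1}$ are normal and commute. A joint eigentuple $(\lambda_1,\dots,\lambda_{k-1})$ is trivial if $|\lambda_i|=\binom{k}{i}_q$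 for all $i$; the eigenvectors of trivial eigentuples are constant on each part; in every nontrivial eigentuple $|\lambda_i|\le\binom{k}{i}\sqrt{q^{i(k-i)}}$ for all $i$. (4) The link of any $v\in V_a$ is identified with the spherical building $\mathbb{P}(\mathbb{F}_q^k)$, whose vertices are the subspaces of $\mathbb{F}_q^k$ other than $0$ and $\mathbb{F}_q^k$ and whose $t$-faces are chains $W_0\subsetneq\dots\subsetneq W_t$; the $j$-dimensional subspaces correspond to the neighbors of $v$ in $V_{a+j}$ (index mod $k$). *)

theory Defs
  imports
    "Jordan_Normal_Form.Missing_VectorSpace"
    "HOL-Algebra.Coset"
    "HOL-Algebra.Generated_Groups"
    "HOL-Number_Theory.Prime_Powers"
    Complex_Main
begin

section \<open>The projective general linear group\<close>

text \<open>
  Fields are \<open>HOL-Algebra\<close> structures given by carriers, not types of class \<open>field\<close>.  Hence the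
  size of a field is not determined by a type, and a constant can be chosen before
  (that is, uniformly in) all fields.  Since every finite field is isomorphic to one whose carrier
  is a set of natural numbers, quantifying over \<open>nat ring\<close> covers all finite fields.
\<close>

definition mat_monoid :: "nat \<Rightarrow> 'a ring \<Rightarrow> (nat \<times> nat \<Rightarrow> 'a) monoid" where
  "mat_monoid k F =
     \<lparr>carrier = ({..<k} \<times> {..<k}) \<rightarrow>\<^sub>E carrier F,
      monoid.mult = (\<lambda>A B. \<lambda>(i, j) \<in> {..<k} \<times> {..<k}.
                       \<Oplus>\<^bsub>F\<^esub> l \<in> {..<k}. A (i, l) \<otimes>\<^bsub>F\<^esub> B (l, j)),
      one = (\<lambda>(i, j) \<in> {..<k} \<times> {..<k}. if i = j then \<one>\<^bsub>F\<^esub> else \<zero>\<^bsub>F\<^esub>)\<rparr>"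

definition GL :: "nat \<Rightarrow> 'a ring \<Rightarrow> (nat \<times> nat \<Rightarrow> 'a) monoid" where
  "GL k F = units_of (mat_monoid k F)"

definition scalar_mats :: "nat \<Rightarrow> 'a ring \<Rightarrow> (nat \<times> nat \<Rightarrow> 'a) set" where
  "scalar_mats k F =
     (\<lambda>c. \<lambda>(i, j) \<in> {..<k} \<times> {..<k}. if i = j then c else \<zero>\<^bsub>F\<^esub>) ` (carrier F - {\<zero>\<^bsub>F\<^esub>})"

definition PGL :: "nat \<Rightarrow> 'a ring \<Rightarrow> (nat \<times> nat \<Rightarrow> 'a) set monoid" where
  "PGL k F = GL k F Mod scalar_mats k F"

section \<open>Cayley graphs and clique complexes\<close>

definition cayley_arcs :: "('v, 'b) monoid_scheme \<Rightarrow> 'v set \<Rightarrow> ('v \<times> 'v) set" where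
  "cayley_arcs G T = {(x, x \<otimes>\<^bsub>G\<^esub> s) | x s. x \<in> carrier G \<and> s \<in> T}"

text \<open>Simplicial complexes are sets of nonempty finite faces; the vertex \<open>v\<close> is the face \<open>{v}\<close>.\<close>

definition clique_complex :: "'v set \<Rightarrow> ('v \<times> 'v) set \<Rightarrow> 'v set set" where
  "clique_complex W E =
     {\<sigma>. \<sigma> \<noteq> {} \<and> finite \<sigma> \<and> \<sigma> \<subseteq> W \<and> (\<forall>x\<in>\<sigma>. \<forall>y\<in>\<sigma>. x \<noteq> y \<longrightarrow> (x, y) \<in> E)}"

definition faces :: "'v set set \<Rightarrow> nat \<Rightarrow> 'v set set" where
  "faces X t = {\<sigma> \<in> X. card \<sigma> = t + 1}"

definition link :: "'v set set \<Rightarrow> 'v \<Rightarrow> 'v set set" where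
  "link X v = {\<tau>. \<tau> \<noteq> {} \<and> v \<notin> \<tau> \<and> insert v \<tau> \<in> X}"

definition simplicial_iso :: "'v set set \<Rightarrow> 'w set set \<Rightarrow> ('v \<Rightarrow> 'w) \<Rightarrow> bool" where
  "simplicial_iso X Y \<phi> \<longleftrightarrow>
     bij_betw \<phi> (\<Union>X) (\<Union>Y) \<and> (\<forall>\<sigma>. \<sigma> \<subseteq> \<Union>X \<longrightarrow> (\<sigma> \<in> X \<longleftrightarrow> \<phi> ` \<sigma> \<in> Y))"

section \<open>The spherical building\<close>

definition coord_space :: "nat \<Rightarrow> 'a ring \<Rightarrow> ('a, nat \<Rightarrow> 'a) module" where
  "coord_space k F = ring.func_space F {..<k}"

definition proper_subspaces :: "nat \<Rightarrow> 'a ring \<Rightarrow> (nat \<Rightarrow> 'a) set set" where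
  "proper_subspaces k F =
     {W. VectorSpace.subspace F W (coord_space k F) \<and>
         W \<noteq> {\<zero>\<^bsub>coord_space k F\<^esub>} \<and> W \<noteq> carrier (coord_space k F)}"

definition subspace_dim :: "nat \<Rightarrow> 'a ring \<Rightarrow> (nat \<Rightarrow> 'a) set \<Rightarrow> nat" where
  "subspace_dim k F W = vectorspace.dim F ((coord_space k F)\<lparr>carrier := W\<rparr>)"

definition spherical_building :: "nat \<Rightarrow> 'a ring \<Rightarrow> (nat \<Rightarrow> 'a) set set set" where
  "spherical_building k F =
     {c. c \<noteq> {} \<and> finite c \<and> c \<subseteq> proper_subspaces k F \<and> (\<forall>W\<in>c. \<forall>W'\<in>c. W \<subseteq> W' \<or> W' \<subseteq> W)}"

section \<open>Gaussian binomials and matrices indexed by a finite set\<close>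

definition gauss_binomial :: "nat \<Rightarrow> nat \<Rightarrow> nat \<Rightarrow> real" where
  "gauss_binomial q k i = (\<Prod>j<i. (real q ^ (k - j) - 1) / (real q ^ (j + 1) - 1))"

definition adj_matrix :: "('v \<times> 'v) set \<Rightarrow> 'v \<Rightarrow> 'v \<Rightarrow> complex" where
  "adj_matrix E x y = (if (x, y) \<in> E then 1 else 0)"

definition matrix_mult ::
  "'v set \<Rightarrow> ('v \<Rightarrow> 'v \<Rightarrow> complex) \<Rightarrow> ('v \<Rightarrow> 'v \<Rightarrow> complex) \<Rightarrow> 'v \<Rightarrow> 'v \<Rightarrow> complex" where
  "matrix_mult W A B x y = (\<Sum>z\<in>W. A x z * B z y)"

definition conj_transpose :: "('v \<Rightarrow> 'v \<Rightarrow> complex) \<Rightarrow> 'v \<Rightarrow> 'v \<Rightarrow> complex" where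
  "conj_transpose A x y = cnj (A y x)"

definition commuting_on ::
  "'v set \<Rightarrow> ('v \<Rightarrow> 'v \<Rightarrow> complex) \<Rightarrow> ('v \<Rightarrow> 'v \<Rightarrow> complex) \<Rightarrow> bool" where
  "commuting_on W A B \<longleftrightarrow> (\<forall>x\<in>W. \<forall>y\<in>W. matrix_mult W A B x y = matrix_mult W B A x y)"

definition normal_on :: "'v set \<Rightarrow> ('v \<Rightarrow> 'v \<Rightarrow> complex) \<Rightarrow> bool" where
  "normal_on W A \<longleftrightarrow> commuting_on W A (conj_transpose A)"

definition joint_eigenvector ::
  "'v set \<Rightarrow> 'i set \<Rightarrow> ('i \<Rightarrow> 'v \<Rightarrow> 'v \<Rightarrow> complex) \<Rightarrow> ('i \<Rightarrow> complex) \<Rightarrow> ('v \<Rightarrow> complex) \<Rightarrow> bool" where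
  "joint_eigenvector W I A ev f \<longleftrightarrow>
     (\<exists>x\<in>W. f x \<noteq> 0) \<and> (\<forall>i\<in>I. \<forall>x\<in>W. (\<Sum>y\<in>W. A i x y * f y) = ev i * f x)"

section \<open>Ramanujan clique complexes\<close>

definition cayley_clique_complex :: "nat \<Rightarrow> ('v, 'b) monoid_scheme \<Rightarrow> (nat \<Rightarrow> 'v set) \<Rightarrow> 'v set set" where
  "cayley_clique_complex k G S = clique_complex (carrier G) (cayley_arcs G (\<Union>i\<in>{1..<k}. S i))"

text \<open>
  \<open>Fq\<close> and \<open>Fqe\<close> are the fields with \<open>q\<close> and \<open>q ^ e\<close> elements, \<open>V 0, \<dots>, V (k - 1)\<close> are the parts and
  \<open>n\<close> is their common size.  The arithmetic construction of the generating sets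
  \<open>S 1, \<dots>, S (k - 1)\<close> by Lubotzky, Samuels and Vishne enters only through the properties assumed
  here, so the locale covers their complexes and every other Cayley clique complex of
  \<open>PGL k Fqe\<close> with these properties.
\<close>

locale ramanujan_clique_complex =
  fixes k q e n :: nat
    and Fq Fqe :: "'a ring"
    and S V :: "nat \<Rightarrow> (nat \<times> nat \<Rightarrow> 'a) set set"
  assumes params: "primepow q" "k \<ge> 2" "e \<ge> 2" "q ^ e > 4 * k\<^sup>2 + 1"
    and fields: "field Fq" "order Fq = q" "field Fqe" "order Fqe = q ^ e"

  assumes generators_carrier: "\<And>i. i \<in> {1..<k} \<Longrightarrow> S i \<subseteq> carrier (PGL k Fqe)"
    and generators_disjoint: "disjoint_family_on S {1..<k}"
    and generators_symmetric:
      "\<And>s. s \<in> (\<Union>i\<in>{1..<k}. S i) \<Longrightarrow> inv\<^bsub>PGL k Fqe\<^esub> s \<in> (\<Union>i\<in>{1..<k}. S i)"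
    and generators_generate:
      "generate (PGL k Fqe) (\<Union>i\<in>{1..<k}. S i) = carrier (PGL k Fqe)"

  assumes parts_cover: "(\<Union>a<k. V a) = carrier (PGL k Fqe)"
    and parts_disjoint: "disjoint_family_on V {..<k}"
    and parts_card: "\<And>a. a < k \<Longrightarrow> card (V a) = n"
    and partite: "\<And>\<sigma> a. \<lbrakk>\<sigma> \<in> faces (cayley_clique_complex k (PGL k Fqe) S) (k - 1); a < k\<rbrakk>
                    \<Longrightarrow> card (\<sigma> \<inter> V a) = 1"

  assumes arcs_parts: "\<And>i a x y. \<lbrakk>i \<in> {1..<k}; a < k; x \<in> V a; (x, y) \<in> cayley_arcs (PGL k Fqe) (S i)\<rbrakk>
                         \<Longrightarrow> y \<in> V ((a + i) mod k)"
    and out_regular: "\<And>i x. \<lbrakk>i \<in> {1..<k}; x \<in> carrier (PGL k Fqe)\<rbrakk>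
                         \<Longrightarrow> real (card {y. (x, y) \<in> cayley_arcs (PGL k Fqe) (S i)}) = gauss_binomial q k i"

  assumes normal: "\<And>i. i \<in> {1..<k}
                     \<Longrightarrow> normal_on (carrier (PGL k Fqe)) (adj_matrix (cayley_arcs (PGL k Fqe) (S i)))"
    and commuting: "\<And>i j. \<lbrakk>i \<in> {1..<k}; j \<in> {1..<k}\<rbrakk>
                     \<Longrightarrow> commuting_on (carrier (PGL k Fqe))
                           (adj_matrix (cayley_arcs (PGL k Fqe) (S i)))
                           (adj_matrix (cayley_arcs (PGL k Fqe) (S j)))"
    and trivial_eigenvectors:
      "\<And>ev f a x y. \<lbrakk>joint_eigenvector (carrier (PGL k Fqe)) {1..<k}
                        (\<lambda>i. adj_matrix (cayley_arcs (PGL k Fqe) (S i))) ev f;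
                      \<forall>i\<in>{1..<k}. cmod (ev i) = gauss_binomial q k i;
                      a < k; x \<in> V a; y \<in> V a\<rbrakk> \<Longrightarrow> f x = f y"
    and nontrivial_eigenvalues:
      "\<And>ev f i. \<lbrakk>joint_eigenvector (carrier (PGL k Fqe)) {1..<k}
                    (\<lambda>i. adj_matrix (cayley_arcs (PGL k Fqe) (S i))) ev f;
                  \<not> (\<forall>i\<in>{1..<k}. cmod (ev i) = gauss_binomial q k i); i \<in> {1..<k}\<rbrakk>
         \<Longrightarrow> cmod (ev i) \<le> real (k choose i) * sqrt (real q ^ (i * (k - i)))"

  assumes link_building:
      "\<And>a v. \<lbrakk>a < k; v \<in> V a\<rbrakk> \<Longrightarrow>
         \<exists>\<phi>. simplicial_iso (spherical_building k Fq)
                (link (cayley_clique_complex k (PGL k Fqe) S) v) \<phi> \<and>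
             (\<forall>j\<in>{1..<k}.
                \<phi> ` {W \<in> proper_subspaces k Fq. subspace_dim k Fq W = j} =
                {w \<in> V ((a + j) mod k). (v, w) \<in> cayley_arcs (PGL k Fqe) (\<Union>i\<in>{1..<k}. S i)})"

end

theory Submission
  imports Defs "HOL-Analysis.Analysis"
begin

text \<open>
  Three of the five residues modulo 5 always contain \<open>a\<close>, \<open>a + j\<close>, \<open>a - j\<close> for some \<open>a\<close> and
  \<open>j \<in> {1, 2}\<close>.  So a face with three vertices in \<open>U\<close> has a vertex \<open>v \<in> U\<close> in whose link, the
  building of \<open>F\<^sub>q\<^sup>5\<close>, it is a complete flag whose members of dimensions 1 and 4 (\<open>j = 1\<close>)
  or 2 and 3 (\<open>j = 2\<close>) lie in \<open>U\<close>.  Let \<open>d\<^sub>i\<close> be the number of neighbours of \<open>v\<close> in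
  \<open>U\<close> along \<open>S i\<close>.  Bounds for the number of incidences between subspaces of these dimensions give
  \<open>O(q\<^bsup>5/2\<^esup> (d\<^sub>1\<^sup>2 + d\<^sub>4\<^sup>2) + q\<^bsup>13/2\<^esup>)\<close>, respectively
  \<open>O(q\<^bsup>1/2\<^esup> (d\<^sub>2\<^sup>2 + d\<^sub>3\<^sup>2) + q\<^bsup>13/2\<^esup>)\<close>, such faces at \<open>v\<close>.  The spectral gap gives
  \<open>\<Sum>\<^sub>v d\<^sub>i\<^sup>2 = O(q\<^bsup>i(5-i)\<^esup> |U|)\<close>, and summing over \<open>v \<in> U\<close> proves the theorem.

  The spectral gap is only assumed for joint eigenvectors.  It is turned into an operator norm bound
  on the invariant space of functions with sum zero on every part: there a maximiser of the norm of
  \<open>A\<^sub>i f\<close> exists by compactness, and the eigenspace of \<open>A\<^sub>i\<^sup>* A\<^sub>i\<close> containing it has a joint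
  eigenvector because the \<open>A\<^sub>i\<close> commute and are closed under adjoints.
\<close>

section \<open>Operator norms from joint eigenvectors\<close>

text \<open>Extension by 0 off \<open>W\<close> lets eigenvector equations and commutation be stated
  as equalities of functions on the whole type.\<close>

definition mat_app :: "'v set \<Rightarrow> ('v \<Rightarrow> 'v \<Rightarrow> complex) \<Rightarrow> ('v \<Rightarrow> complex) \<Rightarrow> 'v \<Rightarrow> complex" where
  "mat_app W A f = (\<lambda>x. if x \<in> W then \<Sum>y\<in>W. A x y * f y else 0)"

definition inner_on :: "'v set \<Rightarrow> ('v \<Rightarrow> complex) \<Rightarrow> ('v \<Rightarrow> complex) \<Rightarrow> complex" where
  "inner_on W f g = (\<Sum>x\<in>W. f x * cnj (g x))"

definition sqnorm_on :: "'v set \<Rightarrow> ('v \<Rightarrow> complex) \<Rightarrow> real" where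
  "sqnorm_on W f = (\<Sum>x\<in>W. (cmod (f x))\<^sup>2)"

definition hermitian_on :: "'v set \<Rightarrow> ('v \<Rightarrow> 'v \<Rightarrow> complex) \<Rightarrow> bool" where
  "hermitian_on W A \<longleftrightarrow> (\<forall>x\<in>W. \<forall>y\<in>W. conj_transpose A x y = A x y)"

text \<open>Closedness refers to the product topology on functions. For finite \<open>W\<close>,
  vanishing off \<open>W\<close> leaves finitely many free coordinates, and closedness then gives
  compact unit spheres.\<close>

definition closed_subspace :: "'v set \<Rightarrow> ('v \<Rightarrow> complex) set \<Rightarrow> bool" where
  "closed_subspace W E \<longleftrightarrow> closed E \<and> (\<lambda>_. 0) \<in> E \<and> (\<forall>f\<in>E. \<forall>x. x \<notin> W \<longrightarrow> f x = 0) \<and>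
     (\<forall>f\<in>E. \<forall>g\<in>E. \<forall>c. (\<lambda>x. f x + c * g x) \<in> E)"

lemma closed_subspace_lincomb:
  assumes "closed_subspace W E" "f \<in> E" "g \<in> E"
  shows "(\<lambda>x. c * f x + d * g x) \<in> E"
proof -
  have lin: "(\<lambda>x. f x + c * g x) \<in> E" if "f \<in> E" "g \<in> E" for f g c
    using assms(1) that by (simp add: closed_subspace_def)
  have "(\<lambda>_. 0) \<in> E" using assms(1) by (simp add: closed_subspace_def)
  from lin[OF lin[OF this assms(2), of c] assms(3), of d] show ?thesis by simp
qed

lemma mat_app_lincomb:
  "mat_app W A (\<lambda>x. f x + c * g x) = (\<lambda>x. mat_app W A f x + c * mat_app W A g x)"
  by (auto simp: mat_app_def fun_eq_iff sum.distrib sum_distrib_left algebra_simps)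

lemma mat_app_scale: "mat_app W A (\<lambda>x. c * g x) = (\<lambda>x. c * mat_app W A g x)"
  by (auto simp: mat_app_def fun_eq_iff sum_distrib_left algebra_simps)

lemma mat_app_matrix_mult: "mat_app W (matrix_mult W A B) f = mat_app W A (mat_app W B f)"
proof -
  have "(\<Sum>y\<in>W. (\<Sum>z\<in>W. A x z * B z y) * f y) = (\<Sum>z\<in>W. A x z * (\<Sum>y\<in>W. B z y * f y))" for x
    by (simp add: sum_distrib_left sum_distrib_right mult.assoc) (rule sum.swap)
  then show ?thesis
    by (auto simp: mat_app_def matrix_mult_def fun_eq_iff)
qed

lemma mat_app_commute:
  assumes "commuting_on W A B"
  shows "mat_app W A (mat_app W B f) = mat_app W B (mat_app W A f)"
proof -
  have "mat_app W (matrix_mult W A B) f = mat_app W (matrix_mult W B A) f"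
    using assms by (auto simp: mat_app_def commuting_on_def fun_eq_iff intro!: sum.cong)
  then show ?thesis by (simp add: mat_app_matrix_mult)
qed

lemma inner_on_mat_app:
  "inner_on W (mat_app W A f) g = inner_on W f (mat_app W (conj_transpose A) g)"
proof -
  have "inner_on W (mat_app W A f) g = (\<Sum>x\<in>W. \<Sum>y\<in>W. A x y * f y * cnj (g x))"
    by (simp add: inner_on_def mat_app_def sum_distrib_right)
  also have "\<dots> = (\<Sum>y\<in>W. \<Sum>x\<in>W. A x y * f y * cnj (g x))"
    by (rule sum.swap)
  also have "\<dots> = inner_on W f (mat_app W (conj_transpose A) g)"
    by (simp add: inner_on_def mat_app_def conj_transpose_def sum_distrib_left algebra_simps)
  finally show ?thesis .
qed

lemma mat_app_cong:
  assumes "\<And>x y. x \<in> W \<Longrightarrow> y \<in> W \<Longrightarrow> A x y = B x y"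
  shows "mat_app W A f = mat_app W B f"
  using assms by (auto simp: mat_app_def fun_eq_iff intro!: sum.cong)

lemma inner_on_hermitian:
  assumes "hermitian_on W A"
  shows "inner_on W (mat_app W A f) g = inner_on W f (mat_app W A g)"
proof -
  have "mat_app W (conj_transpose A) g = mat_app W A g"
    using assms by (intro mat_app_cong) (auto simp: hermitian_on_def)
  then show ?thesis by (simp add: inner_on_mat_app)
qed

lemma inner_on_self: "inner_on W f f = of_real (sqnorm_on W f)"
  by (simp add: inner_on_def sqnorm_on_def complex_norm_square del: of_real_power)

lemma cnj_inner_on: "cnj (inner_on W f g) = inner_on W g f"
  by (simp add: inner_on_def mult.commute)

lemma inner_on_lincomb:
  "inner_on W (\<lambda>x. f x + c * g x) h = inner_on W f h + c * inner_on W g h"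
  "inner_on W h (\<lambda>x. f x + c * g x) = inner_on W h f + cnj c * inner_on W h g"
  by (simp_all add: inner_on_def sum.distrib sum_distrib_left algebra_simps)

lemma sqnorm_on_nonneg: "sqnorm_on W f \<ge> 0"
  by (simp add: sqnorm_on_def sum_nonneg)

lemma sqnorm_on_eq_0:
  assumes "finite W" "sqnorm_on W f = 0" "x \<in> W"
  shows "f x = 0"
  using assms by (simp add: sqnorm_on_def sum_nonneg_eq_0_iff)

lemma sqnorm_on_scale: "sqnorm_on W (\<lambda>x. c * f x) = (cmod c)\<^sup>2 * sqnorm_on W f"
  by (simp add: sqnorm_on_def sum_distrib_left norm_mult power_mult_distrib)

lemma sqnorm_on_add_le:
  "sqnorm_on W (\<lambda>x. f x + g x) \<le> 2 * sqnorm_on W f + 2 * sqnorm_on W g"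
proof -
  have "(cmod (f x + g x))\<^sup>2 \<le> 2 * (cmod (f x))\<^sup>2 + 2 * (cmod (g x))\<^sup>2" for x
  proof -
    have "(cmod (f x + g x))\<^sup>2 \<le> (cmod (f x) + cmod (g x))\<^sup>2"
      by (intro power_mono norm_triangle_ineq) auto
    also have "\<dots> \<le> 2 * (cmod (f x))\<^sup>2 + 2 * (cmod (g x))\<^sup>2"
      using zero_le_power2[of "cmod (f x) - cmod (g x)"]
      by (simp add: power2_eq_square algebra_simps)
    finally show ?thesis .
  qed
  then show ?thesis
    by (simp add: sqnorm_on_def sum_distrib_left flip: sum.distrib) (rule sum_mono, simp)
qed

section \<open>Eigenvectors as maximisers of quadratic forms\<close>

text \<open>The first-order condition at a maximum: for nonzero \<open>b\<close>, a small step
  \<open>t\<close> with the sign of \<open>b\<close> would make the expression positive.\<close>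

lemma linear_term_zero:
  fixes b c :: real
  assumes "\<And>t. t * b + t\<^sup>2 * c \<le> 0"
  shows "b = 0"
proof (rule ccontr)
  assume "b \<noteq> 0"
  \<comment> \<open>With this choice the linear term is t^2 (|c| + 1), which outweighs the quadratic
    term even for negative \<open>c\<close>.\<close>
  define t where "t = b / (\<bar>c\<bar> + 1)"
  have t: "t * (\<bar>c\<bar> + 1) = b" by (simp add: t_def)
  have "t \<noteq> 0" using \<open>b \<noteq> 0\<close> t by auto
  have "t * b + t\<^sup>2 * c = t\<^sup>2 * (\<bar>c\<bar> + c + 1)"
    unfolding t[symmetric] by (simp add: power2_eq_square algebra_simps)
  moreover have "t\<^sup>2 * (\<bar>c\<bar> + c + 1) > 0"
    using \<open>t \<noteq> 0\<close> by (intro mult_pos_pos) auto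
  ultimately show False using assms[of t] by simp
qed

lemma continuous_on_coord [continuous_intros]:
  "continuous_on S (\<lambda>f :: 'v \<Rightarrow> complex. f x)"
  by (rule continuous_on_subset[OF continuous_on_product_coordinates subset_UNIV])

text \<open>The sphere is a closed subset of a product of unit discs over \<open>W\<close> and
  singletons \<open>{0}\<close> elsewhere, and this product is compact by Tychonoff.\<close>

lemma compact_unit_sphere_on:
  assumes W: "finite W" and E: "closed_subspace W E"
  shows "compact {f \<in> E. sqnorm_on W f = 1}"
proof -
  define B :: "'a \<Rightarrow> complex set" where "B x = (if x \<in> W then cball 0 1 else {0})" for x
  have **: "compact (PiE UNIV B)"
    using compactin_PiE[of "\<lambda>_. euclidean" UNIV B] euclidean_product_topology[where 'a = 'a and 'b = complex]
    by (metis B_def compact_cball compact_sing compactin_euclidean_iff)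
  have "closed {f. sqnorm_on W f = 1}"
    unfolding sqnorm_on_def by (intro closed_Collect_eq continuous_intros)
  then have *: "closed {f \<in> E. sqnorm_on W f = 1}"
    using E by (simp add: closed_subspace_def closed_Int Collect_conj_eq)
  have "{f \<in> E. sqnorm_on W f = 1} \<subseteq> PiE UNIV B"
  proof (intro subsetI PiE_I)
    fix f x assume "f \<in> {f \<in> E. sqnorm_on W f = 1}"
    then have f: "f \<in> E" "sqnorm_on W f = 1" by auto
    show "f x \<in> B x"
    proof (cases "x \<in> W")
      case True
      have "(cmod (f x))\<^sup>2 \<le> 1"
        using member_le_sum[of x W "\<lambda>x. (cmod (f x))\<^sup>2"] True f W by (simp add: sqnorm_on_def)
      then have "cmod (f x) \<le> 1"
        by (simp add: power2_le_imp_le abs_square_le_1 flip: power2_eq_square)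
      then show ?thesis using True by (simp add: B_def)
    next
      case False
      then show ?thesis using f E by (simp add: B_def closed_subspace_def)
    qed
  qed simp
  then have "PiE UNIV B \<inter> {f \<in> E. sqnorm_on W f = 1} = {f \<in> E. sqnorm_on W f = 1}"
    by (rule Int_absorb1)
  with compact_Int_closed[OF ** *] show ?thesis by (simp only:)
qed

text \<open>The quadratic form of \<open>H\<close> attains a maximum \<open>M\<close> on the unit
  sphere of \<open>E\<close>. Varying the maximiser in the direction of its residual H f0 - M f0
  forces that residual to vanish.\<close>

lemma hermitian_max_eigenvalue:
  assumes W: "finite W" and E: "closed_subspace W E" and nz: "g \<in> E" "g x0 \<noteq> 0"
    and H: "hermitian_on W H" and inv: "\<And>f. f \<in> E \<Longrightarrow> mat_app W H f \<in> E"
  obtains M :: real and f0 where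
    "f0 \<in> E" "sqnorm_on W f0 = 1" "mat_app W H f0 = (\<lambda>x. of_real M * f0 x)"
    "\<And>f. f \<in> E \<Longrightarrow> Re (inner_on W (mat_app W H f) f) \<le> M * sqnorm_on W f"
proof -
  define \<phi> where "\<phi> f = Re (inner_on W (mat_app W H f) f)" for f
  have lin: "(\<lambda>x. f x + c * g x) \<in> E" if "f \<in> E" "g \<in> E" for f g c
    using E that by (simp add: closed_subspace_def)
  have scale: "(\<lambda>x. c * g x) \<in> E" if "g \<in> E" for g c
    using lin[of "\<lambda>_. 0" g c] that E by (simp add: closed_subspace_def)
  have zero: "f = (\<lambda>_. 0)" if "f \<in> E" "sqnorm_on W f = 0" for f
    using that E sqnorm_on_eq_0[OF W] by (auto simp: closed_subspace_def fun_eq_iff)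
  have unit: "\<exists>c>0. (\<lambda>x. of_real c * f x) \<in> E \<and> sqnorm_on W (\<lambda>x. of_real c * f x) = 1 \<and> c\<^sup>2 * sqnorm_on W f = 1"
    if "f \<in> E" "sqnorm_on W f \<noteq> 0" for f
  proof -
    have "sqnorm_on W f > 0" using that(2) sqnorm_on_nonneg[of W f] by simp
    then show ?thesis
      using scale[OF that(1), of "of_real (1 / sqrt (sqnorm_on W f))"]
        sqnorm_on_scale[of W "of_real (1 / sqrt (sqnorm_on W f))" f]
      by (intro exI[of _ "1 / sqrt (sqnorm_on W f)"])
        (simp add: power_divide norm_divide)
  qed
  have "sqnorm_on W g \<noteq> 0" using zero nz by fastforce
  then have "{f \<in> E. sqnorm_on W f = 1} \<noteq> {}" using unit nz(1) by blast
  moreover have "continuous_on {f \<in> E. sqnorm_on W f = 1} \<phi>"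
    unfolding \<phi>_def inner_on_def mat_app_def by (simp, intro continuous_intros)
  ultimately have "\<exists>f0\<in>{f \<in> E. sqnorm_on W f = 1}. \<forall>f\<in>{f \<in> E. sqnorm_on W f = 1}. \<phi> f \<le> \<phi> f0"
    by (rule continuous_attains_sup[OF compact_unit_sphere_on[OF W E]])
  then obtain f0 where f0: "f0 \<in> E" "sqnorm_on W f0 = 1"
    and max1: "\<And>f. f \<in> E \<Longrightarrow> sqnorm_on W f = 1 \<Longrightarrow> \<phi> f \<le> \<phi> f0"
    by blast
  define M where "M = \<phi> f0"
  have max: "\<phi> f \<le> M * sqnorm_on W f" if f: "f \<in> E" for f
  proof (cases "sqnorm_on W f = 0")
    case True
    then have "f = (\<lambda>_. 0)" using zero f by blast
    then show ?thesis by (simp add: \<phi>_def inner_on_def sqnorm_on_def)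
  next
    case False
    then obtain c where c: "c > 0" "(\<lambda>x. of_real c * f x) \<in> E"
      "sqnorm_on W (\<lambda>x. of_real c * f x) = 1" "c\<^sup>2 * sqnorm_on W f = 1"
      using unit f by blast
    have "\<phi> (\<lambda>x. of_real c * f x) = c\<^sup>2 * \<phi> f"
      by (simp add: \<phi>_def mat_app_scale inner_on_def sum_distrib_left power2_eq_square algebra_simps)
    then have "c\<^sup>2 * \<phi> f \<le> c\<^sup>2 * (M * sqnorm_on W f)"
      using max1[OF c(2,3)] c(4) by (simp add: M_def algebra_simps)
    then show ?thesis using c(1) by simp
  qed
  define h where "h = (\<lambda>x. mat_app W H f0 x + (- of_real M) * f0 x)"
  have h: "h \<in> E" unfolding h_def by (intro lin inv f0)
  \<comment> \<open>Maximality is tested on f0 + t h. The constant terms cancel, and the linear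
    coefficient is twice the real part of the inner product of H f0 - M f0 with \<open>h\<close>,
    which is \<open>2 * sqnorm_on W h\<close>.\<close>
  have "t * (2 * sqnorm_on W h) + t\<^sup>2 * (\<phi> h - M * sqnorm_on W h) \<le> 0" for t
  proof -
    let ?f = "\<lambda>x. f0 x + of_real t * h x"
    have sym: "Re (inner_on W (mat_app W H h) f0) = Re (inner_on W (mat_app W H f0) h)"
      by (metis H cnj_inner_on cnj.sel(1) inner_on_hermitian)
    have sym2: "Re (inner_on W h f0) = Re (inner_on W f0 h)"
      by (metis cnj_inner_on cnj.sel(1))
    have 1: "\<phi> ?f = M + 2 * t * Re (inner_on W (mat_app W H f0) h) + t\<^sup>2 * \<phi> h"
      using sym by (simp add: \<phi>_def M_def mat_app_lincomb inner_on_lincomb power2_eq_square algebra_simps)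
    have "of_real (sqnorm_on W ?f) = inner_on W ?f ?f" by (simp add: inner_on_self)
    then have "sqnorm_on W ?f = Re (inner_on W ?f ?f)" by (metis Re_complex_of_real)
    then have 2: "sqnorm_on W ?f = 1 + 2 * t * Re (inner_on W f0 h) + t\<^sup>2 * sqnorm_on W h"
      using sym2 f0(2) by (simp add: inner_on_lincomb inner_on_self power2_eq_square algebra_simps)
    have "of_real (sqnorm_on W h) = inner_on W h h" by (simp add: inner_on_self)
    also have "\<dots> = inner_on W (mat_app W H f0) h - of_real M * inner_on W f0 h"
      using inner_on_lincomb(1)[of W "mat_app W H f0" "- of_real M" f0 h] by (simp add: h_def)
    finally have "Re (of_real (sqnorm_on W h)) = Re (inner_on W (mat_app W H f0) h - of_real M * inner_on W f0 h)"
      by simp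
    then have 3: "Re (inner_on W (mat_app W H f0) h) = sqnorm_on W h + M * Re (inner_on W f0 h)"
      by simp
    show ?thesis using max[OF lin[OF f0(1) h, of "of_real t"]] unfolding 1 2 3 by (simp add: algebra_simps)
  qed
  then have "2 * sqnorm_on W h = 0" by (rule linear_term_zero)
  then have "h = (\<lambda>_. 0)" using zero h by simp
  then have "mat_app W H f0 = (\<lambda>x. of_real M * f0 x)"
    by (simp add: h_def fun_eq_iff)
  with that f0 max show ?thesis unfolding \<phi>_def by blast
qed

lemma closed_subspace_eigenspace:
  assumes "finite W" and E: "closed_subspace W E"
  shows "closed_subspace W {f \<in> E. mat_app W H f = (\<lambda>x. c * f x)}"
proof -
  have "{f \<in> E. mat_app W H f = (\<lambda>x. c * f x)} =
      E \<inter> (\<Inter>x. {f. (if x \<in> W then \<Sum>y\<in>W. H x y * f y else 0) = c * f x})"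
    by (auto simp: mat_app_def fun_eq_iff)
  moreover have "closed {f. (if x \<in> W then \<Sum>y\<in>W. H x y * f y else 0) = c * f x}" for x
    by (cases "x \<in> W") (simp_all only: if_True if_False,
      (intro closed_Collect_eq continuous_intros)+)
  ultimately have "closed {f \<in> E. mat_app W H f = (\<lambda>x. c * f x)}"
    using E by (simp only: closed_subspace_def) (intro closed_Int closed_INT, auto)
  moreover have "mat_app W H (\<lambda>_. 0) = (\<lambda>_. 0)"
    by (auto simp: mat_app_def)
  ultimately show ?thesis
    using E by (simp add: closed_subspace_def mat_app_lincomb algebra_simps)
qed

text \<open>Induction on the family with \<open>E\<close> arbitrary: an eigenspace of one operator
  inside \<open>E\<close> is again closed, and commutation makes it invariant under the remaining
  operators.\<close>

lemma hermitian_joint_eigenvector: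
  assumes "finite J" and W: "finite W" and "closed_subspace W E" "\<exists>g\<in>E. \<exists>x. g x \<noteq> 0"
    and "\<And>j. j \<in> J \<Longrightarrow> hermitian_on W (H j)"
    and "\<And>i j f. i \<in> J \<Longrightarrow> j \<in> J \<Longrightarrow> mat_app W (H i) (mat_app W (H j) f) = mat_app W (H j) (mat_app W (H i) f)"
    and "\<And>j f. j \<in> J \<Longrightarrow> f \<in> E \<Longrightarrow> mat_app W (H j) f \<in> E"
  shows "\<exists>f\<in>E. (\<exists>x. f x \<noteq> 0) \<and> (\<forall>j\<in>J. \<exists>c. mat_app W (H j) f = (\<lambda>x. c * f x))"
  using assms(1,3-)
proof (induction J arbitrary: E rule: finite_induct)
  case empty
  then show ?case by blast
next
  case (insert j J)
  obtain g x0 where g: "g \<in> E" "g x0 \<noteq> 0" using insert.prems(2) by blast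
  have hj: "hermitian_on W (H j)" and invj: "\<And>f. f \<in> E \<Longrightarrow> mat_app W (H j) f \<in> E"
    using insert.prems(3,5) by auto
  obtain M f0 where f0: "f0 \<in> E" "sqnorm_on W f0 = 1" "mat_app W (H j) f0 = (\<lambda>x. of_real M * f0 x)"
    using hermitian_max_eigenvalue[OF W insert.prems(1) g hj invj] by metis
  let ?E = "{f \<in> E. mat_app W (H j) f = (\<lambda>x. of_real M * f x)}"
  have "\<exists>x. f0 x \<noteq> 0"
    by (rule ccontr) (use f0(2) in \<open>simp add: sqnorm_on_def\<close>)
  then have "\<exists>f\<in>?E. (\<exists>x. f x \<noteq> 0) \<and> (\<forall>j\<in>J. \<exists>c. mat_app W (H j) f = (\<lambda>x. c * f x))"
    using f0 insert.prems
    by (intro insert.IH closed_subspace_eigenspace W) (auto simp: mat_app_scale)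
  then show ?case by blast
qed

text \<open>The index \<open>st i\<close> names the adjoint of \<open>A i\<close>. The squared norm
  of \<open>A i\<close> on \<open>E\<close> is the top eigenvalue of that adjoint times
  \<open>A i\<close>, and a joint eigenvector in the top eigenspace identifies it with
  \<open>(cmod (ev i))\<^sup>2\<close>.\<close>

theorem commuting_family_norm_bound:
  fixes A :: "'i \<Rightarrow> 'v \<Rightarrow> 'v \<Rightarrow> complex"
  assumes W: "finite W" and I: "finite I" and st: "\<And>i. i \<in> I \<Longrightarrow> st i \<in> I"
    and adj: "\<And>i x y. i \<in> I \<Longrightarrow> x \<in> W \<Longrightarrow> y \<in> W \<Longrightarrow> A (st i) x y = conj_transpose (A i) x y"
    and comm: "\<And>i j. i \<in> I \<Longrightarrow> j \<in> I \<Longrightarrow> commuting_on W (A i) (A j)"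
    and E: "closed_subspace W E"
    and inv: "\<And>i f. i \<in> I \<Longrightarrow> f \<in> E \<Longrightarrow> mat_app W (A i) f \<in> E"
    and ev: "\<And>ev f. joint_eigenvector W I A ev f \<Longrightarrow> f \<in> E \<Longrightarrow> cmod (ev i) \<le> L"
    and i: "i \<in> I" and f: "f \<in> E"
  shows "sqnorm_on W (mat_app W (A i) f) \<le> L\<^sup>2 * sqnorm_on W f"
proof (cases "\<exists>x. f x \<noteq> 0")
  case False
  then have "f = (\<lambda>_. 0)" by auto
  then show ?thesis by (simp add: mat_app_def sqnorm_on_def)
next
  case True
  have adj': "mat_app W (A (st j)) g = mat_app W (conj_transpose (A j)) g" if "j \<in> I" for j g
    using adj that by (intro mat_app_cong)
  have C: "mat_app W (A a) (mat_app W (A b) g) = mat_app W (A b) (mat_app W (A a) g)"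
    if "a \<in> I" "b \<in> I" for a b g
    using mat_app_commute comm that by blast
  define P where "P = matrix_mult W (A (st i)) (A i)"
  have Papp: "mat_app W P g = mat_app W (A (st i)) (mat_app W (A i) g)" for g
    by (simp add: P_def mat_app_matrix_mult)
  have "hermitian_on W P"
    using adj[OF i] by (simp add: hermitian_on_def conj_transpose_def P_def matrix_mult_def mult.commute)
  moreover have "mat_app W P g \<in> E" if "g \<in> E" for g
    using that inv i st by (simp add: Papp)
  ultimately obtain M f0 where f0: "f0 \<in> E" "sqnorm_on W f0 = 1" "mat_app W P f0 = (\<lambda>x. of_real M * f0 x)"
    and max: "\<And>f. f \<in> E \<Longrightarrow> Re (inner_on W (mat_app W P f) f) \<le> M * sqnorm_on W f"
    using hermitian_max_eigenvalue[OF W E f, of _ P] True by metis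
  have P_sq: "inner_on W (mat_app W P g) g = of_real (sqnorm_on W (mat_app W (A i) g))" for g
  proof -
    have "inner_on W (mat_app W P g) g = cnj (inner_on W g (mat_app W (conj_transpose (A i)) (mat_app W (A i) g)))"
      by (simp add: Papp adj'[OF i] cnj_inner_on)
    then show ?thesis
      by (simp add: inner_on_mat_app[symmetric] inner_on_self)
  qed
  let ?E = "{f \<in> E. mat_app W P f = (\<lambda>x. of_real M * f x)}"
  \<comment> \<open>For \<open>c = 1\<close> and \<open>c = \<i>\<close> these are the sum of
    \<open>A j\<close> and its adjoint, and \<i> times their difference. Both are Hermitian, all of
    them commute with one another and with \<open>P\<close>, and together they determine
    \<open>A j\<close>.\<close>
  define H where "H = (\<lambda>(j, c) x y. c * A j x y + cnj c * A (st j) x y)"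
  have Happ: "mat_app W (H (j, c)) g = (\<lambda>x. c * mat_app W (A j) g x + cnj c * mat_app W (A (st j)) g x)" for j c g
    by (auto simp: H_def mat_app_def fun_eq_iff sum.distrib sum_distrib_left algebra_simps)
  have app_add: "mat_app W B (\<lambda>x. c * g x + d * h x) = (\<lambda>x. c * mat_app W B g x + d * mat_app W B h x)" for B c d g h
    using mat_app_lincomb[of W B "\<lambda>x. c * g x" d h] by (simp add: mat_app_scale)
  have PC: "mat_app W P (mat_app W (A j) g) = mat_app W (A j) (mat_app W P g)" if "j \<in> I" for j g
    using C that i st by (simp add: Papp)
  have "\<exists>f\<in>?E. (\<exists>x. f x \<noteq> 0) \<and> (\<forall>j\<in>I \<times> {1, \<i>}. \<exists>c. mat_app W (H j) f = (\<lambda>x. c * f x))"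
  proof (rule hermitian_joint_eigenvector[OF _ W])
    have "\<exists>x. f0 x \<noteq> 0"
      by (rule ccontr) (use f0(2) in \<open>simp add: sqnorm_on_def\<close>)
    then show "\<exists>g\<in>?E. \<exists>x. g x \<noteq> 0" using f0 by blast
    show "closed_subspace W ?E" by (rule closed_subspace_eigenspace[OF W E])
    show "hermitian_on W (H j)" if "j \<in> I \<times> {1, \<i>}" for j
      using that adj by (auto simp: hermitian_on_def conj_transpose_def H_def split: prod.splits)
    show "mat_app W (H a) (mat_app W (H b) g) = mat_app W (H b) (mat_app W (H a) g)"
      if "a \<in> I \<times> {1, \<i>}" "b \<in> I \<times> {1, \<i>}" for a b g
    proof -
      obtain j c k d where ab: "a = (j, c)" "b = (k, d)" by fastforce
      then have jk: "j \<in> I" "k \<in> I" using that by auto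
      show ?thesis
        unfolding ab Happ app_add
        using C[OF jk, of g] C[OF jk(1) st[OF jk(2)], of g] C[OF st[OF jk(1)] jk(2), of g]
          C[OF st[OF jk(1)] st[OF jk(2)], of g]
        by (simp add: fun_eq_iff algebra_simps)
    qed
    show "mat_app W (H a) g \<in> ?E" if "a \<in> I \<times> {1, \<i>}" "g \<in> ?E" for a g
    proof -
      obtain j c where a: "a = (j, c)" by fastforce
      then have j: "j \<in> I" "st j \<in> I" using that st by auto
      have "mat_app W P (mat_app W (H a) g) = (\<lambda>x. of_real M * mat_app W (H a) g x)"
        using that(2) j by (simp add: a Happ app_add PC mat_app_scale algebra_simps)
      then show ?thesis
        using that(2) inv j closed_subspace_lincomb[OF E] by (simp add: a Happ)
    qed
  qed (use I in auto)
  then obtain v where v: "v \<in> E" "mat_app W P v = (\<lambda>x. of_real M * v x)" "\<exists>x. v x \<noteq> 0"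
    and vj: "\<forall>j\<in>I \<times> {1, \<i>}. \<exists>c. mat_app W (H j) v = (\<lambda>x. c * v x)" by blast
  have "\<exists>c. mat_app W (A j) v = (\<lambda>x. c * v x)" if j: "j \<in> I" for j
  proof -
    obtain c d where "mat_app W (H (j, 1)) v = (\<lambda>x. c * v x)" "mat_app W (H (j, \<i>)) v = (\<lambda>x. d * v x)"
      using vj j by blast
    then have c: "mat_app W (A j) v x + mat_app W (A (st j)) v x = c * v x"
      and d: "\<i> * mat_app W (A j) v x - \<i> * mat_app W (A (st j)) v x = d * v x" for x
      by (simp_all add: Happ fun_eq_iff)
    \<comment> \<open>Subtracting \<i> times the second equation from the first cancels the adjoint
      and leaves twice \<open>A j\<close>.\<close>
    have "mat_app W (A j) v x = (c - \<i> * d) / 2 * v x" for x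
    proof -
      have "2 * mat_app W (A j) v x = c * v x - \<i> * (d * v x)"
        unfolding c[symmetric] d[symmetric] by (simp add: algebra_simps)
      then show ?thesis by (simp add: algebra_simps)
    qed
    then show ?thesis by blast
  qed
  then obtain \<mu> where \<mu>: "\<And>j. j \<in> I \<Longrightarrow> mat_app W (A j) v = (\<lambda>x. \<mu> j * v x)" by metis
  have nz: "\<exists>x\<in>W. v x \<noteq> 0" using v(1,3) E by (auto simp: closed_subspace_def)
  have "joint_eigenvector W I A \<mu> v"
    unfolding joint_eigenvector_def
  proof (intro conjI nz ballI)
    fix j x assume "j \<in> I" "x \<in> W"
    then show "(\<Sum>y\<in>W. A j x y * v y) = \<mu> j * v x"
      using fun_cong[OF \<mu>, of j x] by (simp add: mat_app_def)
  qed
  then have L: "cmod (\<mu> i) \<le> L" using ev v(1) by blast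
  \<comment> \<open>Evaluating the quadratic form of \<open>P\<close> at \<open>v\<close> in two
    ways identifies \<open>M\<close> with the squared modulus of the eigenvalue of
    \<open>A i\<close>.\<close>
  have "of_real (M * sqnorm_on W v) = inner_on W (mat_app W P v) v"
    by (simp add: v(2) inner_on_def sqnorm_on_def complex_norm_square sum_distrib_left mult.assoc del: of_real_power)
  also have "\<dots> = of_real ((cmod (\<mu> i))\<^sup>2 * sqnorm_on W v)"
    by (simp add: P_sq \<mu>[OF i] sqnorm_on_scale)
  finally have "M * sqnorm_on W v = (cmod (\<mu> i))\<^sup>2 * sqnorm_on W v"
    using of_real_eq_iff by blast
  moreover have "sqnorm_on W v \<noteq> 0" using nz sqnorm_on_eq_0[OF W] by blast
  ultimately have "M = (cmod (\<mu> i))\<^sup>2" by simp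
  then have "M \<le> L\<^sup>2" using L by (simp add: power_mono)
  have "sqnorm_on W (mat_app W (A i) f) = Re (inner_on W (mat_app W P f) f)"
    by (simp add: P_sq)
  also have "\<dots> \<le> M * sqnorm_on W f" using max f by blast
  also have "\<dots> \<le> L\<^sup>2 * sqnorm_on W f"
    using \<open>M \<le> L\<^sup>2\<close> by (intro mult_right_mono sqnorm_on_nonneg)
  finally show ?thesis .
qed

section \<open>Incidences and flags of subspaces\<close>

lemma card_le_fibres:
  assumes "finite S" "finite R" "f ` S \<subseteq> R" "\<And>y. y \<in> R \<Longrightarrow> card {x \<in> S. f x = y} \<le> c"
  shows "card S \<le> c * card R"
proof -
  have "card S = card (\<Union>y\<in>R. {x \<in> S. f x = y})"
    using assms(3) by (intro arg_cong[of _ _ card]) auto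
  also have "\<dots> \<le> (\<Sum>y\<in>R. card {x \<in> S. f x = y})"
    by (rule card_UN_le) (fact assms(2))
  also have "\<dots> \<le> (\<Sum>y\<in>R. c)"
    by (rule sum_mono) (rule assms(4))
  finally show ?thesis by (simp add: mult.commute)
qed

lemma sum_card_swap:
  assumes "finite A" "finite B"
  shows "(\<Sum>a\<in>A. card {b \<in> B. R a b}) = (\<Sum>b\<in>B. card {a \<in> A. R a b})"
proof -
  have "(\<Sum>a\<in>A. card {b \<in> B. R a b}) = (\<Sum>a\<in>A. \<Sum>b\<in>B. if R a b then 1 else 0)"
    using assms by (simp add: sum.If_cases Collect_conj_eq Int_commute flip: Int_def)
  also have "\<dots> = (\<Sum>b\<in>B. \<Sum>a\<in>A. if R a b then 1 else 0)"
    by (rule sum.swap)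
  also have "\<dots> = (\<Sum>b\<in>B. card {a \<in> A. R a b})"
    using assms by (simp add: sum.If_cases Collect_conj_eq Int_commute flip: Int_def)
  finally show ?thesis .
qed

text \<open>A squared degree counts ordered pairs of neighbours, equal ones included, so a second
  moment becomes a sum of codegrees.\<close>

lemma sum_card_power2:
  fixes R :: "'a \<Rightarrow> 'b \<Rightarrow> bool"
  assumes "finite A" "finite B"
  shows "(\<Sum>a\<in>A. (card {b \<in> B. R a b})\<^sup>2) = (\<Sum>b\<in>B. \<Sum>b'\<in>B. card {a \<in> A. R a b \<and> R a b'})"
proof -
  have "(\<Sum>a\<in>A. (card {b \<in> B. R a b})\<^sup>2) = (\<Sum>a\<in>A. card {(b, b') \<in> B \<times> B. R a b \<and> R a b'})"
  proof (rule sum.cong[OF refl])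
    fix a
    have "{(b, b') \<in> B \<times> B. R a b \<and> R a b'} = {b \<in> B. R a b} \<times> {b \<in> B. R a b}" by auto
    then show "(card {b \<in> B. R a b})\<^sup>2 = card {(b, b') \<in> B \<times> B. R a b \<and> R a b'}"
      by (simp add: power2_eq_square card_cartesian_product)
  qed
  also have "\<dots> = (\<Sum>p\<in>B \<times> B. card {a \<in> A. R a (fst p) \<and> R a (snd p)})"
    using sum_card_swap[of A "B \<times> B" "\<lambda>a p. R a (fst p) \<and> R a (snd p)"] assms
    by (simp add: case_prod_beta' mem_Times_iff conj_assoc)
  also have "\<dots> = (\<Sum>b\<in>B. \<Sum>b'\<in>B. card {a \<in> A. R a b \<and> R a b'})"
    by (simp add: sum.cartesian_product case_prod_beta')
  finally show ?thesis .
qed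

lemma card_incidences:
  assumes "finite A" "finite B"
  shows "card {(a, b) \<in> A \<times> B. R a b} = (\<Sum>a\<in>A. card {b \<in> B. R a b})"
proof -
  have "{(a, b) \<in> A \<times> B. R a b} = Sigma A (\<lambda>a. {b \<in> B. R a b})" by auto
  then show ?thesis using assms by (simp add: card_SigmaI)
qed

text \<open>The finite family of linear subspaces of a vector space over the field with \<open>q\<close> elements, with
  the dimension \<open>d\<close> of a member recorded by its cardinality \<open>q ^ d\<close>.\<close>

locale subspace_family =
  fixes q :: nat and Sub :: "'b set set" and X :: "'b set" and z :: 'b
  assumes q: "q \<ge> 2" and finX: "finite X" and Sub_le: "\<And>W. W \<in> Sub \<Longrightarrow> W \<subseteq> X"
    and zero: "\<And>W. W \<in> Sub \<Longrightarrow> z \<in> W"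
    and inter: "\<And>W W'. W \<in> Sub \<Longrightarrow> W' \<in> Sub \<Longrightarrow> W \<inter> W' \<in> Sub"
    and card_power: "\<And>W. W \<in> Sub \<Longrightarrow> \<exists>d. card W = q ^ d"
begin

definition of_dim :: "nat \<Rightarrow> 'b set set" where
  "of_dim d = {W \<in> Sub. card W = q ^ d}"

lemma of_dimD: "W \<in> of_dim d \<Longrightarrow> W \<in> Sub" "W \<in> of_dim d \<Longrightarrow> card W = q ^ d"
  by (simp_all add: of_dim_def)

lemma finite_of_dim: "finite (of_dim d)"
  by (rule finite_subset[of _ "Pow X"]) (use Sub_le finX in \<open>auto simp: of_dim_def\<close>)

lemma finite_member: "W \<in> Sub \<Longrightarrow> finite W"
  using Sub_le finX finite_subset by blast

section \<open>Intersections, intermediate subspaces and incidences\<close>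

text \<open>The intersection is a proper subspace, and its size is a power of \<open>q\<close>, so
  it falls by at least a factor \<open>q\<close>.\<close>

lemma card_inter_le:
  assumes "W \<in> of_dim (Suc d)" "W' \<in> of_dim (Suc d)" "W \<noteq> W'"
  shows "card (W \<inter> W') \<le> q ^ d"
proof -
  have W: "W \<in> Sub" "W' \<in> Sub" "card W = q ^ Suc d" "card W' = q ^ Suc d"
    using assms of_dimD by auto
  have "W \<inter> W' \<subset> W"
    using W assms(3) card_subset_eq[OF finite_member, of W' W] by auto
  then have "card (W \<inter> W') < q ^ Suc d"
    using psubset_card_mono finite_member W by metis
  moreover obtain e where "card (W \<inter> W') = q ^ e"
    using card_power inter W by blast
  ultimately show ?thesis
    using q by (simp add: power_strict_increasing_iff power_increasing_iff less_Suc_eq_le del: power_Suc)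
qed

text \<open>Distinct members of the family meet exactly in \<open>A\<close>, so the sets
  \<open>W - A\<close> are disjoint subsets of \<open>B\<close>. Each has at least half of
  \<open>q ^ Suc i\<close> elements because \<open>q \<ge> 2\<close>; this is the source of the
  factor 2.\<close>

lemma card_between_le:
  assumes A: "A \<in> of_dim i" and B: "B \<in> Sub" "card B = q ^ (i + Suc m)"
  shows "card {W \<in> of_dim (Suc i). A \<subseteq> W \<and> W \<subseteq> B} \<le> 2 * q ^ m"
proof -
  let ?F = "{W \<in> of_dim (Suc i). A \<subseteq> W \<and> W \<subseteq> B}"
  have fin: "finite ?F" by (simp add: finite_of_dim)
  have finA: "finite A" using A finite_member of_dimD by blast
  have eq: "W \<inter> W' = A" if "W \<in> ?F" "W' \<in> ?F" "W \<noteq> W'" for W W'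
  proof -
    have "finite (W \<inter> W')" using that finite_member of_dimD by auto
    then show ?thesis
      using card_inter_le[of W i W'] that A of_dimD(2)[OF A]
      by (intro card_seteq[symmetric]) auto
  qed
  have "card (\<Union>W\<in>?F. W - A) = (\<Sum>W\<in>?F. card (W - A))"
    using fin eq by (intro card_UN_disjoint) (auto simp: of_dim_def finite_member)
  also have "\<dots> = (\<Sum>W\<in>?F. q ^ Suc i - q ^ i)"
    using finA A by (intro sum.cong refl) (auto simp: card_Diff_subset of_dim_def)
  finally have "card ?F * (q ^ Suc i - q ^ i) = card (\<Union>W\<in>?F. W - A)" by simp
  also have "\<dots> \<le> q ^ (i + Suc m)"
    unfolding B(2)[symmetric] by (rule card_mono) (use finite_member B in auto)
  finally have *: "card ?F * (q ^ Suc i - q ^ i) \<le> q ^ (i + Suc m)" .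
  have "q ^ Suc i \<le> 2 * (q ^ Suc i - q ^ i)"
    using mult_right_mono[OF q, of "q ^ i"] by (simp only: power_Suc diff_mult_distrib2) linarith
  then have "card ?F * q ^ Suc i \<le> card ?F * (2 * (q ^ Suc i - q ^ i))"
    by (rule mult_left_mono) simp
  also have "\<dots> \<le> 2 * q ^ (i + Suc m)" using * by simp
  also have "\<dots> = (2 * q ^ m) * q ^ Suc i" by (simp add: power_add)
  finally show ?thesis using q by simp
qed

text \<open>An expander mixing bound, proved as a variance estimate for the number of members of
  \<open>H\<close> through a vector. For points and hyperplanes in dimension \<open>n + 2\<close>,
  \<open>t\<close> = q^(n/2) is the second singular value of the incidence graph.\<close>

lemma incidence_points_hyperplanes:
  assumes cX: "card X = q ^ (n + 2)" and P: "P \<subseteq> of_dim 1" and H: "H \<subseteq> of_dim (Suc n)"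
    and t: "t > 0" "t\<^sup>2 = real q ^ n"
  shows "real (card {(p, h) \<in> P \<times> H. p \<subseteq> h})
    \<le> real (card P) * real (card H) / real q + t * (real (card P) + real (card H)) / 2"
proof -
  have fin: "finite P" "finite H" using P H finite_of_dim finite_subset by blast+
  define a where "a = real (card H)"
  \<comment> \<open>The mean of \<open>f\<close> over \<open>X\<close>, since a hyperplane makes up
    a fraction 1/q of \<open>X\<close>.\<close>
  define c where "c = a / real q"
  define Q where "Q = real q ^ n"
  have q0: "real q > 0" using q by simp
  have ca: "a = c * real q" using q0 by (simp add: c_def)
  define f where "f x = real (card {h \<in> H. x \<in> h})" for x
  define g where "g p = real (card {h \<in> H. p \<subseteq> h})" for p
  have mem: "{x \<in> X. x \<in> h} = h" "card h = q ^ Suc n" if "h \<in> H" for h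
    using that H Sub_le of_dimD by blast+
  have "(\<Sum>x\<in>X. card {h \<in> H. x \<in> h}) = (\<Sum>h\<in>H. q ^ Suc n)"
    unfolding sum_card_swap[OF finX fin(2)] by (intro sum.cong refl) (simp add: mem)
  then have "(\<Sum>x\<in>X. card {h \<in> H. x \<in> h}) = card H * q ^ Suc n" by simp
  then have "real (\<Sum>x\<in>X. card {h \<in> H. x \<in> h}) = real (card H * q ^ Suc n)" by (rule arg_cong)
  then have sum1: "(\<Sum>x\<in>X. f x) = a * (real q * Q)"
    by (simp add: f_def a_def Q_def)
  have "(\<Sum>x\<in>X. (card {h \<in> H. x \<in> h})\<^sup>2) = (\<Sum>h\<in>H. \<Sum>h'\<in>H. card {x \<in> X. x \<in> h \<and> x \<in> h'})"
    by (rule sum_card_power2[OF finX fin(2)])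
  \<comment> \<open>Distinct hyperplanes share at most \<open>q ^ n\<close> vectors; the conditional
    summand corrects the diagonal.\<close>
  also have "\<dots> \<le> (\<Sum>h\<in>H. \<Sum>h'\<in>H. q ^ n + (if h = h' then q ^ Suc n - q ^ n else 0))"
  proof (intro sum_mono)
    fix h h' assume h: "h \<in> H" "h' \<in> H"
    have "{x \<in> X. x \<in> h \<and> x \<in> h'} = h \<inter> h'" using mem h by blast
    moreover have "q ^ n \<le> q ^ Suc n" using q by (intro power_increasing) auto
    ultimately show "card {x \<in> X. x \<in> h \<and> x \<in> h'} \<le> q ^ n + (if h = h' then q ^ Suc n - q ^ n else 0)"
      using card_inter_le[of h n h'] h H by (auto simp: mem(2))
  qed
  also have "\<dots> = card H * (card H * q ^ n + (q ^ Suc n - q ^ n))"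
    using fin by (simp add: sum.distrib)
  finally have "(\<Sum>x\<in>X. (card {h \<in> H. x \<in> h})\<^sup>2) \<le> card H * (card H * q ^ n + (q ^ Suc n - q ^ n))" .
  then have "real (\<Sum>x\<in>X. (card {h \<in> H. x \<in> h})\<^sup>2) \<le> real (card H * (card H * q ^ n + (q ^ Suc n - q ^ n)))"
    using of_nat_le_iff by blast
  moreover have "real (q ^ Suc n - q ^ n) = real q * Q - Q"
    using q by (subst of_nat_diff) (auto simp: Q_def)
  ultimately have sum2: "(\<Sum>x\<in>X. (f x)\<^sup>2) \<le> a * (a * Q + (real q * Q - Q))"
    by (simp add: f_def a_def Q_def)
  have "(\<Sum>x\<in>X. (f x - c)\<^sup>2) = (\<Sum>x\<in>X. (f x)\<^sup>2) - 2 * c * (\<Sum>x\<in>X. f x) + c\<^sup>2 * real (card X)"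
    by (simp add: power2_diff sum.distrib sum_subtractf mult.commute[of _ c] mult.assoc
        flip: sum_distrib_left sum_distrib_right)
  also have "c\<^sup>2 * real (card X) = a\<^sup>2 * Q"
    unfolding ca by (simp add: cX Q_def power2_eq_square)
  also have "2 * c * (\<Sum>x\<in>X. f x) = 2 * a\<^sup>2 * Q"
    unfolding sum1 ca by (simp add: power2_eq_square)
  \<comment> \<open>The terms quadratic in \<open>a\<close> cancel, so only the diagonal
    contribution survives.\<close>
  finally have var: "(\<Sum>x\<in>X. (f x - c)\<^sup>2) \<le> (real q - 1) * (a * Q)"
    using sum2 by (simp add: power2_eq_square algebra_simps)
  \<comment> \<open>If \<open>h\<close> contains the nonzero \<open>x\<close>, then the intersection
    of \<open>p\<close> and \<open>h\<close> has at least the two elements \<open>x\<close> and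
    \<open>z\<close>; its size is then a positive power of \<open>q\<close>, so it is all of
    \<open>p\<close>.\<close>
  have fg: "f x = g p" if p: "p \<in> P" and x: "x \<in> p - {z}" for p x
  proof -
    have "x \<in> h \<longleftrightarrow> p \<subseteq> h" if h: "h \<in> H" for h
    proof
      assume "x \<in> h"
      have S: "p \<in> Sub" "h \<in> Sub" "card p = q" using p h P H of_dimD by fastforce+
      obtain d where d: "card (p \<inter> h) = q ^ d" using card_power inter S by blast
      have "card {x, z} \<le> card (p \<inter> h)"
        using S zero \<open>x \<in> h\<close> x by (intro card_mono) (auto intro: finite_member)
      then have "d \<noteq> 0" using d x by (intro notI) auto
      then have "card p \<le> card (p \<inter> h)"
        using q S(3) d self_le_power[of q d] by simp
      then have "p \<inter> h = p"
        using finite_member S by (intro card_seteq) auto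
      then show "p \<subseteq> h" by blast
    qed (use x in auto)
    then have "{h \<in> H. x \<in> h} = {h \<in> H. p \<subseteq> h}" by blast
    then show ?thesis by (simp add: f_def g_def)
  qed
  \<comment> \<open>Each point stands for its \<open>q - 1\<close> nonzero vectors, and distinct
    points share none. This produces the factor that cancels the one in \<open>var\<close>.\<close>
  have "(real q - 1) * (\<Sum>p\<in>P. (g p - c)\<^sup>2) = (\<Sum>p\<in>P. \<Sum>x\<in>p - {z}. (f x - c)\<^sup>2)"
    unfolding sum_distrib_left
  proof (rule sum.cong[OF refl])
    fix p assume p: "p \<in> P"
    then have "p \<in> of_dim 1" using P by blast
    then have "card (p - {z}) = q - 1" using zero of_dimD[of p 1] by simp
    moreover have "(\<Sum>x\<in>p - {z}. (f x - c)\<^sup>2) = (\<Sum>x\<in>p - {z}. (g p - c)\<^sup>2)"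
      by (intro sum.cong refl) (simp add: fg[OF p])
    ultimately show "(real q - 1) * (g p - c)\<^sup>2 = (\<Sum>x\<in>p - {z}. (f x - c)\<^sup>2)"
      using q by (simp add: of_nat_diff)
  qed
  also have "\<dots> = (\<Sum>x\<in>(\<Union>p\<in>P. p - {z}). (f x - c)\<^sup>2)"
  proof (rule sum.UNION_disjoint[symmetric])
    show "\<forall>p\<in>P. \<forall>p'\<in>P. p \<noteq> p' \<longrightarrow> (p - {z}) \<inter> (p' - {z}) = {}"
    proof (intro ballI impI)
      fix p p' assume pp: "p \<in> P" "p' \<in> P" "p \<noteq> p'"
      have S: "p \<in> Sub" "p' \<in> Sub" using pp P of_dimD by blast+
      have "card (p \<inter> p') \<le> 1" using card_inter_le[of p 0 p'] pp P by auto
      then have "p \<inter> p' \<subseteq> {z}"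
        using card_le_Suc0_iff_eq[of "p \<inter> p'"] S zero finite_member by auto
      then show "(p - {z}) \<inter> (p' - {z}) = {}" by blast
    qed
    show "\<forall>p\<in>P. finite (p - {z})" using P of_dimD finite_member by blast
  qed (use fin in auto)
  also have "\<dots> \<le> (\<Sum>x\<in>X. (f x - c)\<^sup>2)"
    by (rule sum_mono2[OF finX]) (use P Sub_le of_dimD in blast, simp)
  also note var
  finally have varP: "(\<Sum>p\<in>P. (g p - c)\<^sup>2) \<le> a * Q"
    using q by (simp add: mult_le_cancel_left_pos)
  have "real (card {(p, h) \<in> P \<times> H. p \<subseteq> h}) = (\<Sum>p\<in>P. g p)"
    by (subst card_incidences[OF fin]) (simp add: g_def)
  \<comment> \<open>The weighted inequality 2 (g - c) <= (g - c)^2 / t + t takes the place of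
    Cauchy-Schwarz.\<close>
  also have "\<dots> \<le> (\<Sum>p\<in>P. c + ((g p - c)\<^sup>2 / t + t) / 2)"
  proof (rule sum_mono)
    fix p
    have "0 \<le> (g p - c - t)\<^sup>2 / t" using t by simp
    also have "\<dots> = (g p - c)\<^sup>2 / t + t - 2 * (g p - c)"
      using t by (simp add: power2_eq_square field_simps)
    finally show "g p \<le> c + ((g p - c)\<^sup>2 / t + t) / 2" by argo
  qed
  also have "\<dots> = real (card P) * c + (\<Sum>p\<in>P. (g p - c)\<^sup>2) / t / 2 + real (card P) * t / 2"
    by (simp add: sum.distrib add_divide_distrib flip: sum_divide_distrib)
  also have "\<dots> \<le> real (card P) * c + (a * Q) / t / 2 + real (card P) * t / 2"
    using varP t by (simp add: divide_right_mono)
  also have "(a * Q) / t = a * t"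
    using t by (simp add: Q_def power2_eq_square flip: t(2))
  finally show ?thesis unfolding c_def a_def by (simp add: algebra_simps add_divide_distrib)
qed

text \<open>Two distinct \<open>d\<close>-dimensional subspaces have at most one common \<open>(d + 1)\<close>-dimensional
  extension; this crude codegree bound replaces the second eigenvalue of the incidence graph.\<close>

lemma incidence_consecutive:
  assumes X: "X \<in> Sub" "card X = q ^ (d + Suc m)" and L: "L \<subseteq> of_dim d" and T: "T \<subseteq> of_dim (Suc d)"
    and t: "t > 0"
  shows "real (card {(l, w) \<in> L \<times> T. l \<subseteq> w})
    \<le> ((2 * real q ^ m * real (card L) + (real (card L))\<^sup>2) / t + t * real (card T)) / 2"
proof -
  have fin: "finite L" "finite T" using L T finite_of_dim finite_subset by blast+
  have "(\<Sum>w\<in>T. (card {l \<in> L. l \<subseteq> w})\<^sup>2) = (\<Sum>l\<in>L. \<Sum>l'\<in>L. card {w \<in> T. l \<subseteq> w \<and> l' \<subseteq> w})"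
    by (rule sum_card_power2[OF fin(2,1)])
  \<comment> \<open>On the diagonal the codegree is the number of extensions of \<open>l\<close> in
    \<open>T\<close>, bounded by those inside \<open>X\<close>.\<close>
  also have "\<dots> \<le> (\<Sum>l\<in>L. \<Sum>l'\<in>L. 1 + (if l = l' then 2 * q ^ m else 0))"
  proof (intro sum_mono)
    fix l l' assume l: "l \<in> L" "l' \<in> L"
    show "card {w \<in> T. l \<subseteq> w \<and> l' \<subseteq> w} \<le> 1 + (if l = l' then 2 * q ^ m else 0)"
    proof (cases "l = l'")
      case True
      have "card {w \<in> T. l \<subseteq> w \<and> l' \<subseteq> w} \<le> card {W \<in> of_dim (Suc d). l \<subseteq> W \<and> W \<subseteq> X}"
        using T Sub_le of_dimD by (intro card_mono) (auto simp: finite_of_dim)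
      also have "\<dots> \<le> 2 * q ^ m" using l L X by (intro card_between_le) auto
      finally show ?thesis using True by simp
    next
      case False
      have "w = w'" if w: "w \<in> T" "l \<subseteq> w" "l' \<subseteq> w" "w' \<in> T" "l \<subseteq> w'" "l' \<subseteq> w'" for w w'
      proof (rule ccontr)
        assume "w \<noteq> w'"
        then have le: "card (w \<inter> w') \<le> q ^ d" using card_inter_le w T by blast
        have "finite (w \<inter> w')" using w T of_dimD finite_member by blast
        then have "u = w \<inter> w'" if "u \<in> {l, l'}" for u
          using that l L w le by (intro card_seteq) (auto simp: of_dim_def subset_iff)
        then show False using False by blast
      qed
      then have "card {w \<in> T. l \<subseteq> w \<and> l' \<subseteq> w} \<le> Suc 0"
        using fin by (subst card_le_Suc0_iff_eq) auto
      then show ?thesis by simp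
    qed
  qed
  also have "\<dots> = card L * (card L + 2 * q ^ m)"
    unfolding sum.distrib using fin by (simp add: sum.delta' algebra_simps)
  finally have "real (\<Sum>w\<in>T. (card {l \<in> L. l \<subseteq> w})\<^sup>2) \<le> real (card L * (card L + 2 * q ^ m))"
    using of_nat_le_iff by blast
  then have sq: "(\<Sum>w\<in>T. (real (card {l \<in> L. l \<subseteq> w}))\<^sup>2) \<le> 2 * real q ^ m * real (card L) + (real (card L))\<^sup>2"
    by (simp add: power2_eq_square algebra_simps)
  have "real (card {(l, w) \<in> L \<times> T. l \<subseteq> w}) = (\<Sum>w\<in>T. real (card {l \<in> L. l \<subseteq> w}))"
    by (subst card_incidences[OF fin], subst sum_card_swap[OF fin]) simp
  also have "\<dots> \<le> (\<Sum>w\<in>T. ((real (card {l \<in> L. l \<subseteq> w}))\<^sup>2 / t + t) / 2)"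
  proof (rule sum_mono)
    fix w
    let ?g = "real (card {l \<in> L. l \<subseteq> w})"
    have "0 \<le> (?g - t)\<^sup>2 / t" using t by simp
    also have "\<dots> = ?g\<^sup>2 / t + t - 2 * ?g"
      using t by (simp add: power2_eq_square field_simps)
    finally show "?g \<le> (?g\<^sup>2 / t + t) / 2" by simp
  qed
  also have "\<dots> = ((\<Sum>w\<in>T. (real (card {l \<in> L. l \<subseteq> w}))\<^sup>2) / t + t * real (card T)) / 2"
    by (simp add: sum.distrib flip: sum_divide_distrib)
  also have "\<dots> \<le> ((2 * real q ^ m * real (card L) + (real (card L))\<^sup>2) / t + t * real (card T)) / 2"
    using sq t by (simp add: divide_right_mono)
  finally show ?thesis .
qed

section \<open>Complete flags with two prescribed members\<close>

definition flags :: "('b set \<times> 'b set \<times> 'b set \<times> 'b set) set" where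
  "flags = {(A, B, C, D). A \<in> of_dim 1 \<and> B \<in> of_dim 2 \<and> C \<in> of_dim 3 \<and> D \<in> of_dim 4 \<and>
     A \<subseteq> B \<and> B \<subseteq> C \<and> C \<subseteq> D}"

lemma finite_flags: "finite flags"
  by (rule finite_subset[of _ "of_dim 1 \<times> of_dim 2 \<times> of_dim 3 \<times> of_dim 4"])
    (auto simp: flags_def finite_of_dim)

lemma card_between_le':
  assumes "A \<in> of_dim i" "B \<in> of_dim (i + Suc m)" "F \<subseteq> {W \<in> of_dim (Suc i). A \<subseteq> W \<and> W \<subseteq> B}"
  shows "card F \<le> 2 * q ^ m"
proof -
  have "card F \<le> card {W \<in> of_dim (Suc i). A \<subseteq> W \<and> W \<subseteq> B}"
    using assms(3) by (intro card_mono) (simp_all add: finite_of_dim)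
  also have "\<dots> \<le> 2 * q ^ m"
    using assms of_dimD by (intro card_between_le) auto
  finally show ?thesis .
qed

text \<open>First \<open>C\<close> is forgotten, then \<open>B\<close>: there are at most 2q choices
  of \<open>C\<close> between \<open>B\<close> and \<open>D\<close>, and at most 2q^2 choices of
  \<open>B\<close> between \<open>A\<close> and \<open>D\<close>.\<close>

lemma flags_point_hyperplane:
  assumes PH: "P \<subseteq> of_dim 1" "H \<subseteq> of_dim 4"
  shows "card {(A, B, C, D) \<in> flags. A \<in> P \<and> D \<in> H} \<le> 4 * q ^ 3 * card {(p, h) \<in> P \<times> H. p \<subseteq> h}"
proof -
  let ?S = "{(A, B, C, D) \<in> flags. A \<in> P \<and> D \<in> H}"
  let ?f = "\<lambda>(A, B, C, D). (A, B, D)" and ?g = "\<lambda>(A, B, D). (A, D)"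
  let ?R = "{(p, h) \<in> P \<times> H. p \<subseteq> h}"
  have finS: "finite ?S" by (rule finite_subset[OF _ finite_flags]) auto
  have finR: "finite ?R"
    by (rule finite_subset[of _ "of_dim 1 \<times> of_dim 4"]) (use PH finite_of_dim in auto)
  have "card ?S \<le> (2 * q ^ 1) * card (?f ` ?S)"
  proof (rule card_le_fibres[OF finS])
    fix y assume "y \<in> ?f ` ?S"
    then obtain A B D where y: "y = (A, B, D)" "B \<in> of_dim 2" "D \<in> of_dim 4"
      by (auto simp: flags_def)
    have "{x \<in> ?S. ?f x = y} \<subseteq> (\<lambda>C. (A, B, C, D)) ` {W \<in> of_dim (Suc 2). B \<subseteq> W \<and> W \<subseteq> D}"
      by (auto simp: y flags_def image_iff numeral_3_eq_3)
    then have "card {x \<in> ?S. ?f x = y} \<le> card {W \<in> of_dim (Suc 2). B \<subseteq> W \<and> W \<subseteq> D}"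
      by (rule surj_card_le[rotated]) (simp add: finite_of_dim)
    also have "\<dots> \<le> 2 * q ^ 1" using y by (intro card_between_le'[of B 2 D]) auto
    finally show "card {x \<in> ?S. ?f x = y} \<le> 2 * q ^ 1" .
  qed (use finS in auto)
  also have "card (?f ` ?S) \<le> (2 * q ^ 2) * card ?R"
  proof (rule card_le_fibres[of _ _ ?g])
    show "?g ` ?f ` ?S \<subseteq> ?R" by (force simp: flags_def)
    fix y assume "y \<in> ?R"
    then obtain A D where y: "y = (A, D)" "A \<in> of_dim 1" "D \<in> of_dim 4"
      using PH by auto
    have "{x \<in> ?f ` ?S. ?g x = y} \<subseteq> (\<lambda>B. (A, B, D)) ` {W \<in> of_dim (Suc 1). A \<subseteq> W \<and> W \<subseteq> D}"
      by (force simp: y flags_def image_iff numeral_2_eq_2)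
    then have "card {x \<in> ?f ` ?S. ?g x = y} \<le> card {W \<in> of_dim (Suc 1). A \<subseteq> W \<and> W \<subseteq> D}"
      by (rule surj_card_le[rotated]) (simp add: finite_of_dim)
    also have "\<dots> \<le> 2 * q ^ 2" using y by (intro card_between_le'[of A 1 D]) auto
    finally show "card {x \<in> ?f ` ?S. ?g x = y} \<le> 2 * q ^ 2" .
  qed (use finS finR in auto)
  finally show ?thesis by (simp add: power3_eq_cube power2_eq_square mult_ac)
qed

text \<open>The outer members are independent: at most 2q choices of \<open>A\<close> between the
  zero space \<open>{z}\<close> and \<open>B\<close>, and at most 2q choices of \<open>D\<close>
  between \<open>C\<close> and \<open>X\<close>.\<close>

lemma flags_middle:
  assumes X: "X \<in> of_dim 5" and LT: "L \<subseteq> of_dim 2" "T \<subseteq> of_dim 3" and z: "{z} \<in> Sub"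
  shows "card {(A, B, C, D) \<in> flags. B \<in> L \<and> C \<in> T} \<le> 4 * q ^ 2 * card {(l, w) \<in> L \<times> T. l \<subseteq> w}"
proof -
  let ?S = "{(A, B, C, D) \<in> flags. B \<in> L \<and> C \<in> T}"
  let ?R = "{(l, w) \<in> L \<times> T. l \<subseteq> w}"
  let ?f = "\<lambda>(A, B, C, D). (B, C)"
  have finS: "finite ?S" by (rule finite_subset[OF _ finite_flags]) auto
  have finR: "finite ?R"
    by (rule finite_subset[of _ "of_dim 2 \<times> of_dim 3"]) (use LT finite_of_dim in auto)
  have z0: "{z} \<in> of_dim 0" using z by (simp add: of_dim_def)
  have "card ?S \<le> (2 * q ^ 1 * (2 * q ^ 1)) * card ?R"
  proof (rule card_le_fibres[OF finS finR, of ?f])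
    show "?f ` ?S \<subseteq> ?R" by (auto simp: flags_def)
    fix y assume "y \<in> ?R"
    then obtain B C where y: "y = (B, C)" "B \<in> of_dim 2" "C \<in> of_dim 3" using LT by auto
    let ?As = "{A \<in> of_dim (Suc 0). {z} \<subseteq> A \<and> A \<subseteq> B}" and ?Ds = "{D \<in> of_dim (Suc 3). C \<subseteq> D \<and> D \<subseteq> X}"
    have "{x \<in> ?S. ?f x = y} \<subseteq> (\<lambda>(A, D). (A, B, C, D)) ` (?As \<times> ?Ds)"
    proof
      fix x assume x: "x \<in> {x \<in> ?S. ?f x = y}"
      obtain A B' C' D where [simp]: "x = (A, B', C', D)" by (cases x)
      have "B' = B" "C' = C" using x by (auto simp: y)
      moreover have "A \<in> ?As" "D \<in> ?Ds"
        using x zero Sub_le by (auto simp: y flags_def of_dim_def)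
      ultimately show "x \<in> (\<lambda>(A, D). (A, B, C, D)) ` (?As \<times> ?Ds)" by (simp add: image_iff)
    qed
    then have "card {x \<in> ?S. ?f x = y} \<le> card (?As \<times> ?Ds)"
      by (rule surj_card_le[rotated]) (simp add: finite_of_dim)
    also have "\<dots> = card ?As * card ?Ds" by (rule card_cartesian_product)
    also have "\<dots> \<le> 2 * q ^ 1 * (2 * q ^ 1)"
      using y X z0
      by (intro mult_mono card_between_le'[of "{z}" 0 B] card_between_le'[of C 3 X]) (auto simp: numeral_eq_Suc)
    finally show "card {x \<in> ?S. ?f x = y} \<le> 2 * q ^ 1 * (2 * q ^ 1)" .
  qed
  then show ?thesis by (simp add: power2_eq_square mult_ac)
qed

text \<open>Writing \<open>s\<close> for the square root of \<open>q\<close> makes half-integral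
  powers of \<open>q\<close> polynomial. Terms linear in the degrees are absorbed into their squares
  and a multiple of \<open>s ^ 13\<close>, that is q^(13/2).\<close>

lemma flags_point_hyperplane_bound:
  assumes X: "X \<in> of_dim 5" and PH: "P \<subseteq> of_dim 1" "H \<subseteq> of_dim 4" and s: "s > 0" "s\<^sup>2 = real q"
  shows "real (card {(A, B, C, D) \<in> flags. A \<in> P \<and> D \<in> H})
    \<le> 3 * s ^ 5 * ((real (card P))\<^sup>2 + (real (card H))\<^sup>2) + 2 * s ^ 13"
proof -
  define a b where "a = real (card P)" and "b = real (card H)"
  have s1: "s \<ge> 1" by (rule power2_le_imp_le) (use s q in auto)
  have "real (card {(p, h) \<in> P \<times> H. p \<subseteq> h}) \<le> a * b / real q + s ^ 3 * (a + b) / 2"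
    unfolding a_def b_def
    by (rule incidence_points_hyperplanes[where n = 3])
      (use X PH s in \<open>auto simp: of_dim_def numeral_eq_Suc power_mult_distrib simp flip: s(2)\<close>)
  then have "4 * s ^ 6 * real (card {(p, h) \<in> P \<times> H. p \<subseteq> h}) \<le> 4 * s ^ 6 * (a * b / s\<^sup>2 + s ^ 3 * (a + b) / 2)"
    unfolding s(2) using s by (intro mult_left_mono) auto
  also have "\<dots> = 4 * s ^ 4 * (a * b) + 2 * s ^ 9 * (a + b)"
    using s(1) by (simp add: field_simps eval_nat_numeral)
  also have "4 * s ^ 4 * (a * b) \<le> 2 * s ^ 5 * (a\<^sup>2 + b\<^sup>2)"
  proof -
    have "2 * (a * b) \<le> a\<^sup>2 + b\<^sup>2" using sum_squares_bound[of a b] by simp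
    moreover have "s ^ 4 \<le> s ^ 5" using s1 by (intro power_increasing) auto
    ultimately have "s ^ 4 * (2 * (a * b)) \<le> s ^ 5 * (a\<^sup>2 + b\<^sup>2)"
      using s by (intro mult_mono) (auto simp: a_def b_def)
    then show ?thesis by (simp add: mult_ac)
  qed
  also have "2 * s ^ 9 * (a + b) \<le> s ^ 5 * (a\<^sup>2 + b\<^sup>2) + 2 * s ^ 13"
  proof -
    \<comment> \<open>At degree \<open>s ^ 4\<close> the linear term \<open>2 * s ^ 9 * a\<close>
      equals the sum \<open>s ^ 5 * a\<^sup>2 + s ^ 13\<close> that bounds it; likewise for
      \<open>b\<close>.\<close>
    have "0 \<le> s ^ 5 * (a - s ^ 4)\<^sup>2 + s ^ 5 * (b - s ^ 4)\<^sup>2" using s by simp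
    then show ?thesis by (simp add: power2_eq_square algebra_simps eval_nat_numeral)
  qed
  finally have "4 * s ^ 6 * real (card {(p, h) \<in> P \<times> H. p \<subseteq> h}) \<le> 3 * s ^ 5 * (a\<^sup>2 + b\<^sup>2) + 2 * s ^ 13"
    by (simp add: algebra_simps)
  moreover have "real (card {(A, B, C, D) \<in> flags. A \<in> P \<and> D \<in> H}) \<le> real (4 * q ^ 3 * card {(p, h) \<in> P \<times> H. p \<subseteq> h})"
    using flags_point_hyperplane[OF PH] of_nat_le_iff by blast
  moreover have "real q ^ 3 = s ^ 6" by (simp flip: s(2) power_mult)
  ultimately show ?thesis unfolding a_def b_def by simp
qed

lemma flags_middle_bound:
  assumes X: "X \<in> of_dim 5" and LT: "L \<subseteq> of_dim 2" "T \<subseteq> of_dim 3" and z: "{z} \<in> Sub"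
    and s: "s > 0" "s\<^sup>2 = real q"
  shows "real (card {(A, B, C, D) \<in> flags. B \<in> L \<and> C \<in> T})
    \<le> 4 * s * ((real (card L))\<^sup>2 + (real (card T))\<^sup>2) + 3 * s ^ 13"
proof -
  define a b where "a = real (card L)" and "b = real (card T)"
  have s1: "s \<ge> 1" by (rule power2_le_imp_le) (use s q in auto)
  \<comment> \<open>The weight \<open>s ^ 3\<close> is chosen so that, after multiplication by
    \<open>4 * s ^ 4\<close>, the square of \<open>a\<close> has coefficient \<open>2 * s\<close>.
    This fits squared degrees whose sum over the small set is of order \<open>s ^ 12\<close> times
    its size.\<close>
  have "real (card {(l, w) \<in> L \<times> T. l \<subseteq> w}) \<le> ((2 * real q ^ 2 * a + a\<^sup>2) / s ^ 3 + s ^ 3 * b) / 2"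
    unfolding a_def b_def
    by (rule incidence_consecutive[where m = 2 and d = 2])
      (use X LT s(1) in \<open>auto simp: of_dim_def numeral_eq_Suc simp del: power_Suc intro: zero_less_power\<close>)
  then have "4 * s ^ 4 * real (card {(l, w) \<in> L \<times> T. l \<subseteq> w})
      \<le> 4 * s ^ 4 * (((2 * (s\<^sup>2) ^ 2 * a + a\<^sup>2) / s ^ 3 + s ^ 3 * b) / 2)"
    unfolding s(2) using s by (intro mult_left_mono) auto
  also have "\<dots> = 4 * s ^ 5 * a + 2 * s * a\<^sup>2 + 2 * s ^ 7 * b"
    using s(1) by (simp add: field_simps eval_nat_numeral)
  also have "4 * s ^ 5 * a \<le> 4 * s ^ 7 * a"
    using s1 by (intro mult_right_mono mult_left_mono power_increasing) (auto simp: a_def)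
  also have "4 * s ^ 7 * a + 2 * s * a\<^sup>2 + 2 * s ^ 7 * b \<le> 4 * s * (a\<^sup>2 + b\<^sup>2) + 3 * s ^ 13"
  proof -
    \<comment> \<open>The squares centred at \<open>s ^ 6\<close> absorb both linear terms at a cost
      of \<open>3 * s ^ 13\<close>; the last summand fills up the coefficient of
      \<open>b\<^sup>2\<close>.\<close>
    have "0 \<le> 2 * (s * (a - s ^ 6)\<^sup>2) + s * (b - s ^ 6)\<^sup>2 + 3 * (s * b\<^sup>2)" using s by simp
    then show ?thesis by (simp add: power2_eq_square algebra_simps eval_nat_numeral)
  qed
  finally have "4 * s ^ 4 * real (card {(l, w) \<in> L \<times> T. l \<subseteq> w}) \<le> 4 * s * (a\<^sup>2 + b\<^sup>2) + 3 * s ^ 13"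
    by simp
  moreover have "real (card {(A, B, C, D) \<in> flags. B \<in> L \<and> C \<in> T}) \<le> real (4 * q ^ 2 * card {(l, w) \<in> L \<times> T. l \<subseteq> w})"
    using flags_middle[OF X LT z] of_nat_le_iff by blast
  moreover have "real q ^ 2 = s ^ 4" by (simp flip: s(2) power_mult)
  ultimately show ?thesis unfolding a_def b_def by simp
qed

end

section \<open>Subspaces over a finite field\<close>

text \<open>Coordinates in a finite basis give a bijection between the carrier and the functions
  from the basis to the field.\<close>

lemma (in vectorspace) card_carrier_eq_power_dim:
  assumes fin: "finite (carrier V)"
  shows "card (carrier V) = Coset.order K ^ dim"
proof -
  have "gen_set (carrier V)"
    using span_is_subset2[of "carrier V"] in_own_span[of "carrier V"] by auto
  then have "fin_dim" using fin unfolding fin_dim_def by blast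
  then obtain B where B: "finite B" "basis B" using finite_basis_exists by blast
  have BV: "B \<subseteq> carrier V" using B(2) by (simp add: basis_def)
  have uniq: "\<forall>v. v \<in> carrier V \<longrightarrow> (\<exists>!a. a \<in> B \<rightarrow>\<^sub>E carrier K \<and> lincomb a B = v)"
    using basis_criterion[OF B(1) BV] B(2) by blast
  have closed: "lincomb a B \<in> carrier V" if "a \<in> B \<rightarrow>\<^sub>E carrier K" for a
    using that BV by (intro lincomb_closed) auto
  have "bij_betw (\<lambda>a. lincomb a B) (B \<rightarrow>\<^sub>E carrier K) (carrier V)"
  proof (rule bij_betwI')
    show "lincomb a B = lincomb b B \<longleftrightarrow> a = b" if "a \<in> B \<rightarrow>\<^sub>E carrier K" "b \<in> B \<rightarrow>\<^sub>E carrier K" for a b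
      using uniq closed that by blast
  qed (use uniq closed in blast)+
  then have "card (carrier V) = card (B \<rightarrow>\<^sub>E carrier K)" by (simp add: bij_betw_same_card)
  also have "\<dots> = Coset.order K ^ card B" using B(1) by (simp add: card_PiE Coset.order_def)
  also have "card B = dim" using dim_basis[OF B] by simp
  finally show ?thesis .
qed

lemma coord_space_vectorspace:
  assumes "field F"
  shows "vectorspace F (coord_space k F)"
proof -
  interpret field F by fact
  show ?thesis
    unfolding coord_space_def vectorspace_def using func_space_is_module assms by blast
qed

lemma carrier_coord_space:
  assumes "field F"
  shows "carrier (coord_space k F) = {..<k} \<rightarrow>\<^sub>E carrier F"
proof -
  interpret field F by fact
  show ?thesis by (simp add: coord_space_def func_space_def)
qed

lemma finite_coord_space:
  assumes "field F" "finite (carrier F)"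
  shows "finite (carrier (coord_space k F))"
  using assms by (simp add: carrier_coord_space finite_PiE)

lemma card_coord_space:
  assumes "field F"
  shows "card (carrier (coord_space k F)) = Coset.order F ^ k"
  using assms by (simp add: carrier_coord_space card_PiE Coset.order_def)

lemma subspace_subset:
  assumes "VectorSpace.subspace F W M"
  shows "W \<subseteq> carrier M"
  using assms by (simp add: VectorSpace.subspace_def submodule_def)

lemma card_subspace:
  assumes "field F" "finite (carrier F)" "VectorSpace.subspace F W (coord_space k F)"
  shows "card W = Coset.order F ^ subspace_dim k F W"
proof -
  interpret V: vectorspace F "coord_space k F" by (rule coord_space_vectorspace) fact
  interpret W: vectorspace F "(coord_space k F)\<lparr>carrier := W\<rparr>"
    by (rule V.subspace_is_vs) fact
  have "finite W"
    using subspace_subset[OF assms(3)] finite_coord_space[OF assms(1,2)] finite_subset by blast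
  then show ?thesis using W.card_carrier_eq_power_dim by (simp add: subspace_dim_def)
qed

lemma subspace_inter:
  assumes "VectorSpace.subspace F W M" "VectorSpace.subspace F W' M"
  shows "VectorSpace.subspace F (W \<inter> W') M"
proof -
  have "submodule F (W \<inter> W') M"
    using assms by (auto simp: VectorSpace.subspace_def submodule_def)
  then show ?thesis using assms by (simp add: VectorSpace.subspace_def)
qed

lemma subspace_zero_mem:
  assumes "VectorSpace.subspace F W M"
  shows "\<zero>\<^bsub>M\<^esub> \<in> W"
  using assms by (auto simp: VectorSpace.subspace_def submodule_def)

lemma subspace_family_coord_space:
  assumes F: "field F" "Coset.order F = q" and q: "q \<ge> 2"
  shows "subspace_family q {W. VectorSpace.subspace F W (coord_space k F)}
    (carrier (coord_space k F)) \<zero>\<^bsub>coord_space k F\<^esub>"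
proof -
  have fin: "finite (carrier F)" using F q by (intro card_ge_0_finite) (simp add: Coset.order_def)
  show ?thesis
  proof
    show "\<exists>d. card W = q ^ d" if "W \<in> {W. VectorSpace.subspace F W (coord_space k F)}" for W
      using card_subspace[OF F(1) fin, of W k] F(2) that by auto
  qed (use q F fin in \<open>auto intro: finite_coord_space dest: subspace_subset subspace_zero_mem subspace_inter\<close>)
qed

lemma carrier_subspace:
  assumes "vectorspace F M"
  shows "VectorSpace.subspace F (carrier M) M"
proof -
  interpret vectorspace F M by fact
  have "LinearCombinations.submodule F (carrier M) M"
    using vectorspace.axioms(1)[OF assms] by (simp add: LinearCombinations.submodule_def)
  then show ?thesis unfolding VectorSpace.subspace_def using assms by blast
qed

lemma zero_subspace:
  assumes "vectorspace F M"
  shows "VectorSpace.subspace F {\<zero>\<^bsub>M\<^esub>} M"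
proof -
  interpret vectorspace F M by fact
  have "submodule F {\<zero>\<^bsub>M\<^esub>} M"
    using vectorspace.axioms(1)[OF assms] by (simp add: LinearCombinations.submodule_def)
  then show ?thesis unfolding VectorSpace.subspace_def using assms by blast
qed

section \<open>Neighbourhoods in Ramanujan clique complexes\<close>

lemma finite_carrier_PGL:
  assumes "finite (carrier F)"
  shows "finite (carrier (PGL k F))"
proof -
  have "finite (carrier (mat_monoid k F))"
    using assms by (simp add: mat_monoid_def finite_PiE)
  then have "finite (carrier (GL k F))"
    by (rule finite_subset[rotated]) (auto simp: GL_def units_of_def Units_def)
  then show ?thesis
    by (simp add: PGL_def FactGroup_def RCOSETS_def)
qed

text \<open>Each denominator is at least half of its power of \<open>q\<close>, which costs a factor
  2 per term. The exponents k - 2j - 1 add up to \<open>i * (k - i)\<close>.\<close>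

lemma gauss_binomial_le:
  assumes "q \<ge> 2" "i \<le> k"
  shows "gauss_binomial q k i \<le> 2 ^ i * real q ^ (i * (k - i))"
proof -
  have "gauss_binomial q k i \<le> (\<Prod>j<i. 2 * (real q ^ (k - j) / real q ^ (j + 1)))"
    unfolding gauss_binomial_def
  proof (rule prod_mono)
    fix j
    define a b where "a = real q ^ (k - j)" and "b = real q ^ (j + 1)"
    have "real q ^ 1 \<le> b" unfolding b_def using assms(1) by (intro power_increasing) auto
    then have b: "2 \<le> b" using assms(1) by simp
    have a: "1 \<le> a" unfolding a_def using assms(1) by (intro one_le_power) simp
    have "(a - 1) / (b - 1) \<le> a / (b / 2)"
      using a b by (intro frac_le) auto
    then show "0 \<le> (real q ^ (k - j) - 1) / (real q ^ (j + 1) - 1) \<and>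
        (real q ^ (k - j) - 1) / (real q ^ (j + 1) - 1) \<le> 2 * (real q ^ (k - j) / real q ^ (j + 1))"
      unfolding a_def[symmetric] b_def[symmetric] using a b by (simp add: mult.commute)
  qed
  also have "\<dots> = 2 ^ i * (\<Prod>j<i. real q ^ (k - j) / real q ^ (j + 1))"
    by (subst prod.distrib) (simp only: prod_constant card_lessThan)
  also have "(\<Prod>j<i. real q ^ (k - j) / real q ^ (j + 1)) = real q ^ (i * (k - i))"
    using assms(2)
  proof (induction i)
    case (Suc i)
    then obtain m where k: "k = Suc i + m" using le_Suc_ex by blast
    have "real q ^ (i * Suc m) * real q ^ Suc m = real q ^ (Suc i * m) * real q ^ Suc i"
      unfolding power_add[symmetric] by (rule arg_cong[of _ _ "power _"]) simp
    then have step: "real q ^ (i * Suc m) * (real q ^ Suc m / real q ^ Suc i) = real q ^ (Suc i * m)"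
      using assms(1) by (simp only: times_divide_eq_right) (simp add: nonzero_divide_eq_eq del: power_Suc mult_Suc)
    have "k - i = Suc m" "k - Suc i = m" using k by auto
    moreover have "(\<Prod>j<i. real q ^ (k - j) / real q ^ (j + 1)) = real q ^ (i * (k - i))"
      using Suc by simp
    ultimately show ?case
      using step by (simp only: prod.lessThan_Suc Suc_eq_plus1[symmetric])
  qed simp
  finally show ?thesis .
qed

section \<open>Arcs, parts and reversal\<close>

context ramanujan_clique_complex
begin

abbreviation "verts \<equiv> carrier (PGL k Fqe)"
abbreviation "arcs i \<equiv> cayley_arcs (PGL k Fqe) (S i)"
abbreviation "all_arcs \<equiv> cayley_arcs (PGL k Fqe) (\<Union>i\<in>{1..<k}. S i)"
abbreviation "complex \<equiv> cayley_clique_complex k (PGL k Fqe) S"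

definition nbrs :: "nat \<Rightarrow> (nat \<times> nat \<Rightarrow> 'a) set set \<Rightarrow> (nat \<times> nat \<Rightarrow> 'a) set \<Rightarrow> (nat \<times> nat \<Rightarrow> 'a) set set"
  where "nbrs i U x = {y \<in> U. (x, y) \<in> arcs i}"

lemma q_ge_2: "q \<ge> 2"
  using params(1) primepow_gt_Suc_0 by fastforce

lemma finite_fields: "finite (carrier Fq)" "finite (carrier Fqe)"
  using fields(2,4) q_ge_2 by (auto simp: Coset.order_def intro!: card_ge_0_finite)

lemma finite_verts: "finite verts"
  by (rule finite_carrier_PGL) (rule finite_fields)

lemma part_subset: "a < k \<Longrightarrow> V a \<subseteq> verts"
  using parts_cover by blast

lemma finite_part: "a < k \<Longrightarrow> finite (V a)"
  using part_subset finite_verts finite_subset by blast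

lemma part_of:
  assumes "x \<in> verts"
  obtains a where "a < k" "x \<in> V a"
  using assms parts_cover by blast

lemma part_unique: "x \<in> V a \<Longrightarrow> x \<in> V b \<Longrightarrow> a < k \<Longrightarrow> b < k \<Longrightarrow> a = b"
  using parts_disjoint by (auto simp: disjoint_family_on_def)

lemma all_arcsE:
  assumes "(x, y) \<in> all_arcs"
  obtains i where "i \<in> {1..<k}" "(x, y) \<in> arcs i"
  using assms unfolding cayley_arcs_def by blast

lemma arcs_subset: "i \<in> {1..<k} \<Longrightarrow> arcs i \<subseteq> all_arcs"
  unfolding cayley_arcs_def by blast

lemma reverse_index: "i \<in> {1..<k} \<Longrightarrow> k - i \<in> {1..<k} \<and> k - (k - i) = i"
  by auto

lemma mod_reverse:
  assumes "i \<in> {1..<k}" "a < k"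
  shows "((a + i) mod k + (k - i)) mod k = a"
proof -
  have "((a + i) mod k + (k - i)) mod k = (a + i + (k - i)) mod k" by (rule mod_add_left_eq)
  also have "a + i + (k - i) = a + k" using assms(1) by simp
  finally show ?thesis using assms(2) by simp
qed

lemma arc_source: "(x, y) \<in> arcs i \<Longrightarrow> x \<in> verts"
  by (auto simp: cayley_arcs_def)

lemma arc_target:
  assumes "(x, y) \<in> arcs i" "i \<in> {1..<k}"
  shows "y \<in> verts"
proof -
  obtain a where "a < k" "x \<in> V a" by (rule part_of[OF arc_source[OF assms(1)]])
  then have "y \<in> V ((a + i) mod k)" using arcs_parts assms by blast
  then show ?thesis using part_subset[of "(a + i) mod k"] params by auto
qed

text \<open>The class of an arc is the difference of the part indices of its ends, which determines
  it modulo \<open>k\<close> and hence exactly.\<close>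

lemma arc_index:
  assumes "(x, y) \<in> all_arcs" "a < k" "x \<in> V a" "y \<in> V ((a + j) mod k)" "j < k"
  shows "(x, y) \<in> arcs j"
proof -
  obtain i where i: "i \<in> {1..<k}" "(x, y) \<in> arcs i" using assms(1) all_arcsE by blast
  have "(a + i) mod k = (a + j) mod k"
    using arcs_parts[OF i(1) assms(2,3) i(2)] assms(2,4) part_unique by simp
  then have "i = j" using i(1) assms(2,5) by (auto simp: mod_if split: if_splits)
  then show ?thesis using i by simp
qed

text \<open>Adjacency is symmetric because every neighbour of \<open>v\<close> is a vertex of the link of \<open>v\<close>; no
  group structure on \<open>PGL\<close> is needed.\<close>

lemma arc_reverse:
  assumes i: "i \<in> {1..<k}" and xy: "(x, y) \<in> arcs i"
  shows "(y, x) \<in> arcs (k - i)"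
proof -
  obtain a where a: "a < k" "x \<in> V a" by (rule part_of[OF arc_source[OF xy]])
  have y: "y \<in> V ((a + i) mod k)" using arcs_parts i a xy by blast
  obtain \<phi> where iso: "simplicial_iso (spherical_building k Fq) (link complex x) \<phi>"
    and imgs: "\<forall>j\<in>{1..<k}. \<phi> ` {W \<in> proper_subspaces k Fq. subspace_dim k Fq W = j} =
                {w \<in> V ((a + j) mod k). (x, w) \<in> all_arcs}"
    using link_building[OF a] by (elim exE conjE)
  note img = bspec[OF imgs i]
  have "y \<in> \<phi> ` {W \<in> proper_subspaces k Fq. subspace_dim k Fq W = i}"
    unfolding img using y subsetD[OF arcs_subset[OF i] xy] by simp
  then obtain W where W: "W \<in> proper_subspaces k Fq" "y = \<phi> W" by blast
  then have B: "{W} \<in> spherical_building k Fq" by (simp add: spherical_building_def)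
  then have "\<phi> ` {W} \<in> link complex x"
    using iso unfolding simplicial_iso_def by (meson Union_upper)
  then have "x \<noteq> y" "{x, y} \<in> complex" using W(2) by (auto simp: link_def)
  then have yx: "(y, x) \<in> all_arcs"
    by (auto simp: cayley_clique_complex_def clique_complex_def)
  have "((a + i) mod k + (k - i)) mod k = a"
    by (rule mod_reverse[OF i a(1)])
  then show ?thesis using arc_index[OF yx _ y, of "k - i"] a i by simp
qed

text \<open>Makes \<open>k - i\<close> the index of the adjoint, as the operator norm bound
  requires.\<close>

lemma adj_matrix_reverse:
  assumes "i \<in> {1..<k}"
  shows "adj_matrix (arcs (k - i)) x y = conj_transpose (adj_matrix (arcs i)) x y"
  using arc_reverse[OF assms, of y x] arc_reverse[of "k - i" x y] reverse_index[OF assms]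
  by (auto simp: conj_transpose_def adj_matrix_def)

lemma sum_adj_matrix_row:
  assumes i: "i \<in> {1..<k}" and x: "a < k" "x \<in> V a"
  shows "(\<Sum>y\<in>verts. adj_matrix (arcs i) x y * (f y :: complex)) = (\<Sum>y | (x, y) \<in> arcs i. f y)"
proof -
  have "(\<Sum>y\<in>verts. adj_matrix (arcs i) x y * f y) = (\<Sum>y\<in>{y. (x, y) \<in> arcs i}. adj_matrix (arcs i) x y * f y)"
    using arc_target i finite_verts by (intro sum.mono_neutral_right) (auto simp: adj_matrix_def)
  then show ?thesis by (simp add: adj_matrix_def)
qed

text \<open>The in-neighbours of \<open>y\<close> along \<open>S i\<close> are its out-neighbours
  along \<open>S (k - i)\<close>, so out-regularity also fixes the in-degrees.\<close>

lemma sum_adj_matrix_column: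
  assumes i: "i \<in> {1..<k}" and a: "a < k" and y: "y \<in> verts"
  shows "(\<Sum>x\<in>V a. adj_matrix (arcs i) x y) =
    (if y \<in> V ((a + i) mod k) then of_real (gauss_binomial q k (k - i)) else 0)"
proof -
  have "(\<Sum>x\<in>V a. adj_matrix (arcs i) x y) = of_nat (card {x \<in> V a. (x, y) \<in> arcs i})"
    using finite_part[OF a] by (simp add: adj_matrix_def sum.If_cases Int_def)
  also have "\<dots> = (if y \<in> V ((a + i) mod k) then of_real (gauss_binomial q k (k - i)) else 0)"
  proof (cases "y \<in> V ((a + i) mod k)")
    case True
    have "{x \<in> V a. (x, y) \<in> arcs i} = {x. (y, x) \<in> arcs (k - i)}"
    proof (intro equalityI subsetI)
      fix x assume "x \<in> {x. (y, x) \<in> arcs (k - i)}"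
      then have yx: "(y, x) \<in> arcs (k - i)" by simp
      have "x \<in> V (((a + i) mod k + (k - i)) mod k)"
        by (rule arcs_parts[OF _ _ True yx]) (use reverse_index[OF i] a in auto)
      then have "x \<in> V a" unfolding mod_reverse[OF i a] .
      then show "x \<in> {x \<in> V a. (x, y) \<in> arcs i}"
        using arc_reverse[of "k - i" y x] yx reverse_index[OF i] by simp
    qed (use arc_reverse i in auto)
    then have "real (card {x \<in> V a. (x, y) \<in> arcs i}) = gauss_binomial q k (k - i)"
      using out_regular[of "k - i" y] reverse_index[OF i] y by simp
    then have "complex_of_real (real (card {x \<in> V a. (x, y) \<in> arcs i})) = of_real (gauss_binomial q k (k - i))"
      by (rule arg_cong)
    then show ?thesis using True by simp
  next
    case False
    then have "{x \<in> V a. (x, y) \<in> arcs i} = {}" using arcs_parts i a by auto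
    then show ?thesis using False by (simp only: if_False card.empty of_nat_0)
  qed
  finally show ?thesis .
qed

lemma card_verts: "card verts = k * n"
proof -
  have "card (\<Union>a<k. V a) = (\<Sum>a<k. card (V a))"
    using finite_part parts_disjoint by (intro card_UN_disjoint) (auto simp: disjoint_family_on_def)
  then show ?thesis using parts_card parts_cover by simp
qed

section \<open>The spectral gap on functions with sum zero on every part\<close>

text \<open>Among functions supported on the vertices, this is the orthogonal complement of those
  constant on every part, so it contains no trivial eigenvector.\<close>

definition balanced :: "((nat \<times> nat \<Rightarrow> 'a) set \<Rightarrow> complex) set" where
  "balanced = {f. (\<forall>x. x \<notin> verts \<longrightarrow> f x = 0) \<and> (\<forall>a<k. (\<Sum>x\<in>V a. f x) = 0)}"

lemma closed_subspace_balanced: "closed_subspace verts balanced"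
proof -
  have "balanced = (\<Inter>x\<in>- verts. {f. f x = 0}) \<inter> (\<Inter>a\<in>{..<k}. {f. (\<Sum>x\<in>V a. f x) = 0})"
    by (auto simp: balanced_def)
  moreover have "closed \<dots>"
    by (intro closed_Int closed_INT ballI closed_Collect_eq continuous_intros)
  ultimately have "closed balanced" by simp
  then show ?thesis
    by (auto simp: closed_subspace_def balanced_def sum.distrib simp flip: sum_distrib_left)
qed

text \<open>Summing the rows of one part gives a column sum that is constant on
  \<open>V ((a + i) mod k)\<close> and zero elsewhere, and \<open>f\<close> has sum zero on that
  part.\<close>

lemma mat_app_balanced:
  assumes i: "i \<in> {1..<k}" and f: "f \<in> balanced"
  shows "mat_app verts (adj_matrix (arcs i)) f \<in> balanced"
proof -
  have "(\<Sum>x\<in>V a. mat_app verts (adj_matrix (arcs i)) f x) = 0" if a: "a < k" for a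
  proof -
    let ?D = "complex_of_real (gauss_binomial q k (k - i))"
    have "(\<Sum>x\<in>V a. mat_app verts (adj_matrix (arcs i)) f x)
        = (\<Sum>x\<in>V a. \<Sum>y\<in>verts. adj_matrix (arcs i) x y * f y)"
      using part_subset[OF a] by (intro sum.cong) (auto simp: mat_app_def)
    also have "\<dots> = (\<Sum>y\<in>verts. (\<Sum>x\<in>V a. adj_matrix (arcs i) x y) * f y)"
      unfolding sum_distrib_right by (rule sum.swap)
    also have "\<dots> = (\<Sum>y\<in>verts. if y \<in> V ((a + i) mod k) then ?D * f y else 0)"
      using sum_adj_matrix_column[OF i a] by (intro sum.cong) auto
    also have "\<dots> = (\<Sum>y\<in>V ((a + i) mod k). ?D * f y)"
      using part_subset[of "(a + i) mod k"] a finite_verts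
      by (simp add: Int_absorb1 flip: sum.inter_restrict)
    also have "\<dots> = 0"
      using f a by (simp add: balanced_def flip: sum_distrib_left)
    finally show ?thesis .
  qed
  then show ?thesis by (simp add: balanced_def mat_app_def)
qed

definition ramanujan_bound :: "nat \<Rightarrow> real" where
  "ramanujan_bound i = real (k choose i) * sqrt (real q ^ (i * (k - i)))"

text \<open>A trivial eigenvector is constant on every part, so sum zero would make it vanish; only
  the nontrivial case remains.\<close>

lemma balanced_eigenvalue_bound:
  assumes f: "joint_eigenvector verts {1..<k} (\<lambda>i. adj_matrix (arcs i)) ev f" "f \<in> balanced"
    and i: "i \<in> {1..<k}"
  shows "cmod (ev i) \<le> ramanujan_bound i"
proof (cases "\<forall>i\<in>{1..<k}. cmod (ev i) = gauss_binomial q k i")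
  case False
  show ?thesis unfolding ramanujan_bound_def by (rule nontrivial_eigenvalues[OF f(1) False i])
next
  case True
  have "f x = 0" if x: "x \<in> verts" for x
  proof -
    obtain a where a: "a < k" "x \<in> V a" by (rule part_of[OF x])
    have "(\<Sum>y\<in>V a. f y) = (\<Sum>y\<in>V a. f x)"
      using trivial_eigenvectors[OF f(1) True a(1) _ a(2)] by (intro sum.cong) auto
    then have "of_nat (card (V a)) * f x = 0" using f(2) a(1) by (simp add: balanced_def)
    then show ?thesis using a finite_part[OF a(1)] by auto
  qed
  then show ?thesis using f(1) by (auto simp: joint_eigenvector_def)
qed

lemma sqnorm_on_adjacency_balanced:
  assumes i: "i \<in> {1..<k}" and f: "f \<in> balanced"
  shows "sqnorm_on verts (mat_app verts (adj_matrix (arcs i)) f) \<le> (ramanujan_bound i)\<^sup>2 * sqnorm_on verts f"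
proof (rule commuting_family_norm_bound[where I = "{1..<k}" and st = "\<lambda>i. k - i" and E = balanced
      and A = "\<lambda>i. adj_matrix (arcs i)"])
  show "cmod (ev i) \<le> ramanujan_bound i"
    if "joint_eigenvector verts {1..<k} (\<lambda>i. adj_matrix (arcs i)) ev f" "f \<in> balanced" for ev f
    using balanced_eigenvalue_bound that i by blast
qed (use finite_verts adj_matrix_reverse commuting closed_subspace_balanced mat_app_balanced i f in auto)

text \<open>The indicator \<open>u\<close> of \<open>U\<close> splits into its part averages
  \<open>p\<close> and a balanced remainder \<open>h\<close>. The spectral gap controls the image of
  \<open>h\<close>, and the degree bound together with the smallness of \<open>U\<close> controls
  the image of \<open>p\<close>.\<close>

theorem sum_nbrs_square_le:
  assumes i: "i \<in> {1..<k}" and U: "U \<subseteq> verts" and n: "n > 0"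
    and small: "real (card U) * real q ^ (i * (k - i)) \<le> real n"
  shows "(\<Sum>x\<in>verts. (real (card (nbrs i U x)))\<^sup>2)
    \<le> (4 * (1 + real k) * (real (k choose i))\<^sup>2 + 2 * real k * 4 ^ i) * real q ^ (i * (k - i)) * real (card U)"
proof -
  let ?A = "mat_app verts (adj_matrix (arcs i))"
  define Q where "Q = real q ^ (i * (k - i))"
  define c where "c = real (card U)"
  have finU: "finite U" using U finite_verts finite_subset by blast
  have Q1: "1 \<le> Q" unfolding Q_def using q_ge_2 by (intro one_le_power) simp
  have cn: "c * Q \<le> n" using small by (simp add: c_def Q_def)
  have c0: "0 \<le> c" by (simp add: c_def)
  have "c * 1 \<le> c * Q" using Q1 c0 by (intro mult_left_mono) auto
  then have cn1: "c \<le> n" using cn by simp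
  define part where "part x = (THE a. a < k \<and> x \<in> V a)" for x
  have part: "part x = a" if "a < k" "x \<in> V a" for x a
    unfolding part_def using that part_unique by (intro the_equality) auto
  \<comment> \<open>The density of \<open>U\<close> in a part, chosen so that \<open>h\<close> has
    sum zero there.\<close>
  define d where "d a = real (card (U \<inter> V a)) / real n" for a
  have d: "0 \<le> d a" "d a \<le> c / n" for a
    using card_mono[of U "U \<inter> V a"] finU n by (auto simp: d_def c_def divide_right_mono)
  define u where "u x = (if x \<in> U then 1 else 0 :: complex)" for x
  define p where "p x = (if x \<in> verts then of_real (d (part x)) else 0 :: complex)" for x
  define h where "h = (\<lambda>x. u x - p x)"
  have sq_p: "sqnorm_on verts p \<le> k * c\<^sup>2 / n"
  proof -
    have "sqnorm_on verts p \<le> (\<Sum>x\<in>verts. (c / n)\<^sup>2)"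
      unfolding sqnorm_on_def using d by (intro sum_mono power_mono) (auto simp: p_def)
    also have "\<dots> = k * c\<^sup>2 / n" using n by (simp add: card_verts power2_eq_square)
    finally show ?thesis .
  qed
  have sq_u: "sqnorm_on verts u = c"
  proof -
    have "sqnorm_on verts u = (\<Sum>x\<in>verts. if x \<in> U then 1 else 0)"
      unfolding sqnorm_on_def by (intro sum.cong) (auto simp: u_def)
    then show ?thesis using U finite_verts by (simp add: c_def sum.If_cases Int_absorb1)
  qed
  have h: "h \<in> balanced"
  proof -
    have "(\<Sum>x\<in>V a. h x) = 0" if a: "a < k" for a
    proof -
      have "(\<Sum>x\<in>V a. p x) = (\<Sum>x\<in>V a. of_real (d a))"
        using part_subset[OF a] part[OF a] by (intro sum.cong) (auto simp: p_def)
      also have "\<dots> = of_nat (card (U \<inter> V a))"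
        using parts_card[OF a] n by (simp add: d_def)
      also have "\<dots> = (\<Sum>x\<in>V a. u x)"
        using finite_part[OF a] by (simp add: u_def sum.If_cases Int_commute)
      finally show ?thesis by (simp add: h_def sum_subtractf)
    qed
    then show ?thesis using U by (auto simp: balanced_def h_def u_def p_def)
  qed
  have "sqnorm_on verts h = sqnorm_on verts (\<lambda>x. u x + (-1) * p x)"
    by (simp add: h_def)
  also have "\<dots> \<le> 2 * sqnorm_on verts u + 2 * sqnorm_on verts (\<lambda>x. (-1) * p x)"
    by (rule sqnorm_on_add_le)
  also have "\<dots> = 2 * c + 2 * sqnorm_on verts p"
    by (subst sqnorm_on_scale) (simp add: sq_u)
  also have "\<dots> \<le> 2 * c + 2 * (k * c)"
  proof -
    have "c * c \<le> c * n" using cn1 c0 by (intro mult_left_mono) auto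
    then have "k * c\<^sup>2 / n \<le> k * c"
      using n mult_left_mono[of "c * c" "c * n" "real k"] by (simp add: field_simps power2_eq_square)
    then show ?thesis using sq_p by simp
  qed
  finally have sq_h: "sqnorm_on verts h \<le> 2 * (1 + real k) * c" by (simp add: algebra_simps)
  have "(ramanujan_bound i)\<^sup>2 = (real (k choose i))\<^sup>2 * Q"
    by (simp add: ramanujan_bound_def power_mult_distrib Q_def)
  then have Ah: "sqnorm_on verts (?A h) \<le> (real (k choose i))\<^sup>2 * Q * (2 * (1 + real k) * c)"
    using sqnorm_on_adjacency_balanced[OF i h] sq_h Q1
    by (auto elim!: order_trans intro!: mult_left_mono)
  \<comment> \<open>Entries of \<open>p\<close> are at most \<open>c / n\<close> and a row has at
    most \<open>2 ^ i * Q\<close> arcs. Squaring and summing leaves one extra factor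
    \<open>c * Q / n\<close>, which \<open>small\<close> bounds by 1.\<close>
  have Ap: "sqnorm_on verts (?A p) \<le> k * (4 ^ i * Q * c)"
  proof -
    have "cmod (?A p x) \<le> 2 ^ i * Q * (c / n)" if x: "x \<in> verts" for x
    proof -
      obtain a where a: "a < k" "x \<in> V a" by (rule part_of[OF x])
      have "?A p x = (\<Sum>y | (x, y) \<in> arcs i. p y)"
        using x sum_adj_matrix_row[OF i a] by (simp add: mat_app_def)
      then have "cmod (?A p x) \<le> (\<Sum>y | (x, y) \<in> arcs i. cmod (p y))"
        using norm_sum by simp
      also have "\<dots> \<le> (\<Sum>y | (x, y) \<in> arcs i. c / n)"
        using d c0 by (intro sum_mono) (auto simp: p_def)
      also have "\<dots> = gauss_binomial q k i * (c / n)"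
        using out_regular[OF i x] by simp
      also have "\<dots> \<le> 2 ^ i * Q * (c / n)"
        unfolding Q_def using c0 i q_ge_2 by (intro mult_right_mono gauss_binomial_le) auto
      finally show ?thesis .
    qed
    then have "sqnorm_on verts (?A p) \<le> (\<Sum>x\<in>verts. (2 ^ i * Q * (c / n))\<^sup>2)"
      unfolding sqnorm_on_def by (intro sum_mono power_mono) auto
    also have "\<dots> = k * (4 ^ i * Q * c) * (c * Q / n)"
      using n by (simp add: card_verts power2_eq_square field_simps flip: power_mult_distrib)
    also have "\<dots> \<le> k * (4 ^ i * Q * c) * 1"
      using cn n c0 Q1 by (intro mult_left_mono) (auto simp: field_simps)
    finally show ?thesis by simp
  qed
  have "(\<Sum>x\<in>verts. (real (card (nbrs i U x)))\<^sup>2) = sqnorm_on verts (?A u)"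
    unfolding sqnorm_on_def
  proof (rule sum.cong[OF refl])
    fix x assume x: "x \<in> verts"
    obtain a where a: "a < k" "x \<in> V a" by (rule part_of[OF x])
    have fin: "finite {y. (x, y) \<in> arcs i}"
      by (rule finite_subset[OF _ finite_verts]) (use arc_target i in auto)
    have "?A u x = (\<Sum>y | (x, y) \<in> arcs i. u y)"
      using x sum_adj_matrix_row[OF i a] by (simp add: mat_app_def)
    also have "\<dots> = of_nat (card (nbrs i U x))"
      using fin by (simp add: u_def sum.If_cases nbrs_def Int_def conj_commute)
    finally show "(real (card (nbrs i U x)))\<^sup>2 = (cmod (?A u x))\<^sup>2" by simp
  qed
  also have "?A u = (\<lambda>x. ?A h x + ?A p x)"
    using mat_app_lincomb[of verts "adj_matrix (arcs i)" h 1 p] by (simp add: h_def)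
  also have "sqnorm_on verts \<dots> \<le> 2 * sqnorm_on verts (?A h) + 2 * sqnorm_on verts (?A p)"
    by (rule sqnorm_on_add_le)
  also have "\<dots> \<le> 2 * ((real (k choose i))\<^sup>2 * Q * (2 * (1 + real k) * c)) + 2 * (k * (4 ^ i * Q * c))"
    using Ah Ap by simp
  also have "\<dots> = (4 * (1 + real k) * (real (k choose i))\<^sup>2 + 2 * real k * 4 ^ i) * Q * c"
    by (simp add: algebra_simps)
  finally show ?thesis by (simp add: Q_def c_def)
qed

end

section \<open>Faces with three vertices in a small set\<close>

lemma residue_shift:
  fixes a b :: nat
  assumes "a < 5" "b < 5"
  obtains j where "j < 5" "b = (a + j) mod 5"
proof
  \<comment> \<open>The summand 5 keeps the subtraction of natural numbers from truncating.\<close>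
  show "(b + 5 - a) mod 5 < 5" by simp
  have "(a + (b + 5 - a) mod 5) mod 5 = (a + (b + 5 - a)) mod 5" by (rule mod_add_right_eq)
  then show "b = (a + (b + 5 - a) mod 5) mod 5" using assms by simp
qed

lemma dimensions: "{1..<5::nat} = {1, 2, 3, 4}"
  by auto

text \<open>Checked by running through all subsets of the five residues; adding 4 or 3 modulo 5
  amounts to subtracting 1 or 2.\<close>

lemma three_residues:
  assumes T: "T \<subseteq> {..<5::nat}" and card: "card T \<ge> 3"
  obtains a where "a \<in> T" "(a + 1) mod 5 \<in> T \<and> (a + 4) mod 5 \<in> T \<or> (a + 2) mod 5 \<in> T \<and> (a + 3) mod 5 \<in> T"
proof -
  have "{..<5::nat} = {0, 1, 2, 3, 4}" by auto
  then have "T \<in> Pow {0, 1, 2, 3, 4}" using T by simp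
  then have "\<exists>a\<in>T. (a + 1) mod 5 \<in> T \<and> (a + 4) mod 5 \<in> T \<or> (a + 2) mod 5 \<in> T \<and> (a + 3) mod 5 \<in> T"
    using card by (simp add: Pow_insert image_Un) (elim disjE; simp)
  then show thesis using that by blast
qed

section \<open>Faces of the five-partite complex as flags in a link\<close>

locale ramanujan_clique_complex_5 = ramanujan_clique_complex 5 q e n Fq Fqe S V
  for q e n and Fq Fqe :: "'a ring" and S V
begin

sublocale building: subspace_family q "{W. VectorSpace.subspace Fq W (coord_space 5 Fq)}"
  "carrier (coord_space 5 Fq)" "\<zero>\<^bsub>coord_space 5 Fq\<^esub>"
  using fields q_ge_2 by (intro subspace_family_coord_space)

text \<open>Sizes determine dimensions because \<open>q \<ge> 2\<close>, and a dimension strictly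
  between 0 and 5 excludes the zero space and the whole space.\<close>

lemma building_of_dim:
  assumes j: "j \<in> {1..<5}"
  shows "building.of_dim j = {W \<in> proper_subspaces 5 Fq. subspace_dim 5 Fq W = j}"
proof -
  have pow: "q ^ x = q ^ y \<longleftrightarrow> x = y" for x y
    using q_ge_2 by (intro power_inject_exp) simp
  have card: "card W = q ^ subspace_dim 5 Fq W" if "VectorSpace.subspace Fq W (coord_space 5 Fq)" for W
    using card_subspace[OF fields(1) finite_fields(1) that] fields(2) by simp
  have c1: "card {\<zero>\<^bsub>coord_space 5 Fq\<^esub>} = q ^ 0" by simp
  have c5: "card (carrier (coord_space 5 Fq)) = q ^ 5"
    using card_coord_space[OF fields(1)] fields(2) by simp
  show ?thesis
  proof (intro equalityI subsetI)
    fix W assume "W \<in> building.of_dim j"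
    then have W: "VectorSpace.subspace Fq W (coord_space 5 Fq)" "card W = q ^ j"
      by (simp_all add: building.of_dim_def)
    have "card W \<noteq> q ^ 0" "card W \<noteq> q ^ 5" unfolding W(2) pow using j by auto
    then have "W \<noteq> {\<zero>\<^bsub>coord_space 5 Fq\<^esub>}" "W \<noteq> carrier (coord_space 5 Fq)"
      using c1 c5 by metis+
    then show "W \<in> {W \<in> proper_subspaces 5 Fq. subspace_dim 5 Fq W = j}"
      using W card[OF W(1)] pow by (simp add: proper_subspaces_def)
  next
    fix W assume "W \<in> {W \<in> proper_subspaces 5 Fq. subspace_dim 5 Fq W = j}"
    then show "W \<in> building.of_dim j"
      using card by (auto simp: proper_subspaces_def building.of_dim_def)
  qed
qed

lemma face_subset: "\<sigma> \<in> faces complex 4 \<Longrightarrow> \<sigma> \<subseteq> verts"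
  by (auto simp: faces_def cayley_clique_complex_def clique_complex_def)

lemma face_arcs: "\<sigma> \<in> faces complex 4 \<Longrightarrow> x \<in> \<sigma> \<Longrightarrow> y \<in> \<sigma> \<Longrightarrow> x \<noteq> y \<Longrightarrow> (x, y) \<in> all_arcs"
  by (simp add: faces_def cayley_clique_complex_def clique_complex_def)

lemma finite_faces: "finite (faces complex 4)"
  by (rule finite_subset[of _ "Pow verts"]) (use face_subset finite_verts in auto)

lemma face_part:
  assumes "\<sigma> \<in> faces complex 4" "a < 5"
  obtains w where "\<sigma> \<inter> V a = {w}"
proof -
  have "card (\<sigma> \<inter> V a) = 1" by (rule partite) (use assms in auto)
  then show thesis using that card_1_singletonE by blast
qed

text \<open>A face meets every part once, so its vertices other than \<open>v\<close> correspond to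
  one subspace of each dimension 1 to 4. They span a face of the link, hence form a chain in the
  building.\<close>

lemma link_flags:
  assumes a: "a < 5" and v: "v \<in> V a"
  obtains \<phi> where "inj_on \<phi> (proper_subspaces 5 Fq)"
    "\<forall>j\<in>{1..<5}. \<phi> ` building.of_dim j = {w. (v, w) \<in> arcs j}"
    "\<forall>\<sigma>\<in>faces complex 4. v \<in> \<sigma> \<longrightarrow>
       (\<exists>A B C D. (A, B, C, D) \<in> building.flags \<and> \<sigma> = {v, \<phi> A, \<phi> B, \<phi> C, \<phi> D})"
proof -
  obtain \<phi> where iso: "simplicial_iso (spherical_building 5 Fq) (link complex v) \<phi>"
    and imgs: "\<forall>j\<in>{1..<5}. \<phi> ` {W \<in> proper_subspaces 5 Fq. subspace_dim 5 Fq W = j} =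
                {w \<in> V ((a + j) mod 5). (v, w) \<in> all_arcs}"
    using link_building[OF a v] by (elim exE conjE)
  have Un: "\<Union>(spherical_building 5 Fq) = proper_subspaces 5 Fq"
  proof (intro equalityI subsetI)
    fix W assume "W \<in> proper_subspaces 5 Fq"
    then have "{W} \<in> spherical_building 5 Fq" by (simp add: spherical_building_def)
    then show "W \<in> \<Union>(spherical_building 5 Fq)" by blast
  qed (auto simp: spherical_building_def)
  have inj: "inj_on \<phi> (proper_subspaces 5 Fq)"
    using iso by (simp add: simplicial_iso_def Un bij_betw_def)
  have chain: "c \<in> spherical_building 5 Fq" if "c \<subseteq> proper_subspaces 5 Fq" "\<phi> ` c \<in> link complex v" for c
    using iso that by (simp add: simplicial_iso_def Un)
  have img: "\<phi> ` building.of_dim j = {w \<in> V ((a + j) mod 5). (v, w) \<in> all_arcs}" if "j \<in> {1..<5}" for j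
    unfolding building_of_dim[OF that] by (rule bspec[OF imgs that])
  have img_arcs: "\<phi> ` building.of_dim j = {w. (v, w) \<in> arcs j}" if j: "j \<in> {1..<5}" for j
  proof -
    have "w \<in> V ((a + j) mod 5) \<and> (v, w) \<in> all_arcs \<longleftrightarrow> (v, w) \<in> arcs j" for w
      using arc_index[of v w a j] arcs_parts[OF j a v, of w] arcs_subset[OF j] a v j by auto
    then show ?thesis unfolding img[OF j] by blast
  qed
  have flag: "\<exists>A B C D. (A, B, C, D) \<in> building.flags \<and> \<sigma> = {v, \<phi> A, \<phi> B, \<phi> C, \<phi> D}"
    if \<sigma>: "\<sigma> \<in> faces complex 4" and v\<sigma>: "v \<in> \<sigma>" for \<sigma>
  proof -
    have "\<exists>W \<in> building.of_dim j. \<sigma> \<inter> V ((a + j) mod 5) = {\<phi> W}" if j: "j \<in> {1..<5}" for j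
    proof -
      have lt: "(a + j) mod 5 < 5" by simp
      obtain w where w: "\<sigma> \<inter> V ((a + j) mod 5) = {w}" by (rule face_part[OF \<sigma> lt])
      have "a \<noteq> (a + j) mod 5" using a j by (auto simp: mod_if split: if_splits)
      then have "v \<noteq> w" using part_unique[of v a "(a + j) mod 5"] v w a by auto
      then have "(v, w) \<in> all_arcs"
        using face_arcs[OF \<sigma> v\<sigma>, of w] w by blast
      then have "w \<in> \<phi> ` building.of_dim j" unfolding img[OF j] using w by blast
      then show ?thesis using w by blast
    qed
    then obtain W where W: "\<And>j. j \<in> {1..<5} \<Longrightarrow> W j \<in> building.of_dim j \<and> \<sigma> \<inter> V ((a + j) mod 5) = {\<phi> (W j)}"
      by metis
    obtain u where u: "\<sigma> \<inter> V a = {u}" by (rule face_part[OF \<sigma> a])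
    have "\<sigma> = insert v ((\<lambda>j. \<phi> (W j)) ` {1..<5})"
    proof (intro equalityI subsetI)
      fix x assume x: "x \<in> \<sigma>"
      then have "x \<in> verts" using face_subset[OF \<sigma>] by blast
      then obtain b where b: "b < 5" "x \<in> V b" by (rule part_of)
      obtain j where j: "j < 5" "b = (a + j) mod 5" by (rule residue_shift[OF a b(1)])
      show "x \<in> insert v ((\<lambda>j. \<phi> (W j)) ` {1..<5})"
      proof (cases "j = 0")
        case True
        then have "x \<in> \<sigma> \<inter> V a" "v \<in> \<sigma> \<inter> V a" using x b j a v v\<sigma> by auto
        then show ?thesis unfolding u by blast
      next
        case False
        then have j': "j \<in> {1..<5}" using j by auto
        have "x \<in> \<sigma> \<inter> V ((a + j) mod 5)" using x b j by simp
        then show ?thesis using W[OF j'] j' by blast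
      qed
    qed (use W v\<sigma> in blast)
    then have \<sigma>_eq: "\<sigma> = {v, \<phi> (W 1), \<phi> (W 2), \<phi> (W 3), \<phi> (W 4)}"
      by (simp only: dimensions image_insert image_empty)
    have "card \<sigma> = 5" using \<sigma> by (simp add: faces_def)
    \<comment> \<open>Otherwise the face would have at most four vertices.\<close>
    have nv: "v \<notin> {\<phi> (W 1), \<phi> (W 2), \<phi> (W 3), \<phi> (W 4)}"
    proof
      assume "v \<in> {\<phi> (W 1), \<phi> (W 2), \<phi> (W 3), \<phi> (W 4)}"
      then have "\<sigma> = set [\<phi> (W 1), \<phi> (W 2), \<phi> (W 3), \<phi> (W 4)]" using \<sigma>_eq by auto
      then have "card \<sigma> \<le> 4" using card_length[of "[\<phi> (W 1), \<phi> (W 2), \<phi> (W 3), \<phi> (W 4)]"] by simp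
      then show False using \<open>card \<sigma> = 5\<close> by simp
    qed
    have "\<sigma> \<in> complex" using \<sigma> by (simp add: faces_def)
    then have "\<phi> ` {W 1, W 2, W 3, W 4} \<in> link complex v"
      using nv \<sigma>_eq by (simp add: link_def)
    moreover have dims: "W 1 \<in> building.of_dim 1" "W 2 \<in> building.of_dim 2" "W 3 \<in> building.of_dim 3"
      "W 4 \<in> building.of_dim 4"
      using W by simp_all
    then have "{W 1, W 2, W 3, W 4} \<subseteq> proper_subspaces 5 Fq"
      using building_of_dim by simp
    ultimately have c: "{W 1, W 2, W 3, W 4} \<in> spherical_building 5 Fq" by (intro chain)
    \<comment> \<open>The building only gives comparability; sizes decide the direction of the
      inclusion.\<close>
    have le: "A \<subseteq> B" if "A \<in> building.of_dim i" "B \<in> building.of_dim j" "i < j" "A \<subseteq> B \<or> B \<subseteq> A" for A B i j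
    proof (rule ccontr)
      assume "\<not> A \<subseteq> B"
      then have "B \<subseteq> A" using that by blast
      then have "card B \<le> card A"
        using that building.of_dimD building.finite_member by (intro card_mono) auto
      then have "q ^ j \<le> q ^ i" using that building.of_dimD(2) by simp
      then show False using \<open>i < j\<close> q_ge_2 by (simp add: power_increasing_iff)
    qed
    have "W 1 \<subseteq> W 2" by (rule le[OF dims(1,2)]) (use c in \<open>auto simp: spherical_building_def\<close>)
    moreover have "W 2 \<subseteq> W 3" by (rule le[OF dims(2,3)]) (use c in \<open>auto simp: spherical_building_def\<close>)
    moreover have "W 3 \<subseteq> W 4" by (rule le[OF dims(3,4)]) (use c in \<open>auto simp: spherical_building_def\<close>)
    ultimately have "(W 1, W 2, W 3, W 4) \<in> building.flags"
      using dims by (simp add: building.flags_def)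
    then show ?thesis using \<sigma>_eq by blast
  qed
  show thesis by (rule that[OF inj]) (use img_arcs flag in blast)+
qed

text \<open>Used with the index pairs (1, 4) and (2, 3), the two patterns \<open>a\<close>,
  \<open>a + j\<close>, \<open>a - j\<close> modulo 5.\<close>

definition faces_through :: "nat \<Rightarrow> nat \<Rightarrow> (nat \<times> nat \<Rightarrow> 'a) set set \<Rightarrow> (nat \<times> nat \<Rightarrow> 'a) set \<Rightarrow> (nat \<times> nat \<Rightarrow> 'a) set set set"
  where "faces_through i j U v =
    {\<sigma> \<in> faces complex 4. v \<in> \<sigma> \<and> (\<exists>x\<in>\<sigma> \<inter> U. (v, x) \<in> arcs i) \<and> (\<exists>x\<in>\<sigma> \<inter> U. (v, x) \<in> arcs j)}"

lemma arcs_disjoint: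
  assumes "(v, x) \<in> arcs i" "(v, x) \<in> arcs j" "i \<in> {1..<5}" "j \<in> {1..<5}"
  shows "i = j"
proof -
  obtain a where a: "a < 5" "v \<in> V a" by (rule part_of[OF arc_source[OF assms(1)]])
  have "(a + i) mod 5 = (a + j) mod 5"
    using arcs_parts[OF assms(3) a assms(1)] arcs_parts[OF assms(4) a assms(2)] part_unique by simp
  then show ?thesis using assms(3,4) a(1) by (auto simp: mod_if split: if_splits)
qed

text \<open>The sets \<open>M j\<close> of subspaces sent into \<open>U\<close> have
  \<open>d j\<close> members because \<phi> is injective. Every face counted is the image of a flag
  with two members in such sets, so the flag bounds apply.\<close>

lemma card_faces_through:
  fixes U
  assumes v: "v \<in> verts" and s: "s > 0" "s\<^sup>2 = real q"
  defines "d i \<equiv> real (card (nbrs i U v))"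
  shows "real (card (faces_through 1 4 U v)) \<le> 3 * s ^ 5 * ((d 1)\<^sup>2 + (d 4)\<^sup>2) + 2 * s ^ 13"
    and "real (card (faces_through 2 3 U v)) \<le> 4 * s * ((d 2)\<^sup>2 + (d 3)\<^sup>2) + 3 * s ^ 13"
proof -
  obtain a where a: "a < 5" "v \<in> V a" by (rule part_of[OF v])
  obtain \<phi> where inj: "inj_on \<phi> (proper_subspaces 5 Fq)"
    and imgs: "\<forall>j\<in>{1..<5}. \<phi> ` building.of_dim j = {w. (v, w) \<in> arcs j}"
    and flag: "\<forall>\<sigma>\<in>faces complex 4. v \<in> \<sigma> \<longrightarrow>
       (\<exists>A B C D. (A, B, C, D) \<in> building.flags \<and> \<sigma> = {v, \<phi> A, \<phi> B, \<phi> C, \<phi> D})"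
    by (rule link_flags[OF a])
  note img = bspec[OF imgs]
  define M where "M j = {W \<in> building.of_dim j. \<phi> W \<in> U}" for j
  have card_M: "real (card (M j)) = d j" if j: "j \<in> {1..<5}" for j
  proof -
    have "\<phi> ` M j = \<phi> ` building.of_dim j \<inter> U" by (auto simp: M_def)
    also have "\<dots> = nbrs j U v" unfolding img[OF j] nbrs_def by blast
    finally have "\<phi> ` M j = nbrs j U v" .
    moreover have "inj_on \<phi> (M j)"
      using inj building_of_dim[OF j] by (auto simp: M_def intro: inj_on_subset)
    ultimately show ?thesis using card_image[of \<phi> "M j"] by (simp add: d_def)
  qed
  have arc: "(v, \<phi> W) \<in> arcs j" if "j \<in> {1..<5}" "W \<in> building.of_dim j" for j W
    using img[OF that(1)] that(2) by blast
  have no_loop: "(v, v) \<notin> arcs i" if i: "i \<in> {1..<5}" for i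
  proof
    assume "(v, v) \<in> arcs i"
    then have "v \<in> V ((a + i) mod 5)" using arcs_parts i a by blast
    then have "a = (a + i) mod 5" using part_unique a by simp
    then show False using i a(1) by (auto simp: mod_if split: if_splits)
  qed
  \<comment> \<open>A vertex reached from \<open>v\<close> along \<open>S j\<close> is neither
    \<open>v\<close> nor the image of a subspace of another dimension, so it can only be the image
    of \<open>W j\<close>.\<close>
  have mem: "\<phi> (W j) \<in> U"
    if W: "\<And>i. i \<in> {1..<5} \<Longrightarrow> W i \<in> building.of_dim i" and j: "j \<in> {1..<5}"
      and x: "x \<in> insert v ((\<lambda>i. \<phi> (W i)) ` {1..<5})" "x \<in> U" "(v, x) \<in> arcs j" for W j x
  proof -
    have "x \<noteq> v" using no_loop[OF j] x(3) by blast
    then obtain i where i: "i \<in> {1..<5}" "x = \<phi> (W i)" using x(1) by blast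
    then have "i = j" using arcs_disjoint[OF arc[OF i(1) W[OF i(1)]] _ i(1) j] x(3) by simp
    then show ?thesis using i x(2) by simp
  qed
  \<comment> \<open>List access treats both index pairs at once; lists start at 0 and dimensions at
    1, which explains \<open>j - 1\<close>.\<close>
  have key: "\<exists>A B C D. (A, B, C, D) \<in> building.flags \<and> \<sigma> = {v, \<phi> A, \<phi> B, \<phi> C, \<phi> D} \<and>
      (\<forall>j\<in>{i, i'}. [A, B, C, D] ! (j - 1) \<in> M j)"
    if \<sigma>: "\<sigma> \<in> faces_through i i' U v" and i: "i \<in> {1..<5}" "i' \<in> {1..<5}" for \<sigma> i i'
  proof -
    have \<sigma>v: "\<sigma> \<in> faces complex 4" "v \<in> \<sigma>" using \<sigma> by (simp_all add: faces_through_def)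
    obtain A B C D where f: "(A, B, C, D) \<in> building.flags" "\<sigma> = {v, \<phi> A, \<phi> B, \<phi> C, \<phi> D}"
      using mp[OF bspec[OF flag \<sigma>v(1)] \<sigma>v(2)] by (elim exE conjE)
    define W where "W j = [A, B, C, D] ! (j - 1)" for j :: nat
    have W_simps: "W 1 = A" "W 2 = B" "W 3 = C" "W 4 = D" by (simp_all add: W_def)
    have Wd: "W j \<in> building.of_dim j" if "j \<in> {1..<5}" for j
    proof -
      have "j = 1 \<or> j = 2 \<or> j = 3 \<or> j = 4" using that by auto
      then show ?thesis using f(1) unfolding building.flags_def by (elim disjE) (simp_all only: W_simps, blast+)
    qed
    have "W j \<in> M j" if j: "j \<in> {i, i'}" for j
    proof -
      have j5: "j \<in> {1..<5}" using j i by blast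
      obtain x where x: "x \<in> \<sigma>" "x \<in> U" "(v, x) \<in> arcs j"
        using \<sigma> j by (auto simp: faces_through_def)
      have "\<sigma> = insert v ((\<lambda>i. \<phi> (W i)) ` {1..<5})"
        by (simp only: dimensions image_insert image_empty W_simps f(2))
      then have "\<phi> (W j) \<in> U" using mem[OF Wd j5 _ x(2,3)] x(1) by simp
      then show ?thesis using Wd[OF j5] by (simp add: M_def)
    qed
    then show ?thesis using f unfolding W_def by blast
  qed
  let ?\<chi> = "\<lambda>(A, B, C, D). {v, \<phi> A, \<phi> B, \<phi> C, \<phi> D}"
  have M: "M j \<subseteq> building.of_dim j" for j by (auto simp: M_def)
  have X: "carrier (coord_space 5 Fq) \<in> building.of_dim 5"
    using card_coord_space[OF fields(1)] carrier_subspace[OF coord_space_vectorspace[OF fields(1)]] fields(2)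
    by (simp add: building.of_dim_def)
  have Z: "{\<zero>\<^bsub>coord_space 5 Fq\<^esub>} \<in> {W. VectorSpace.subspace Fq W (coord_space 5 Fq)}"
    using zero_subspace[OF coord_space_vectorspace[OF fields(1)]] by simp
  have "faces_through 1 4 U v \<subseteq> ?\<chi> ` {(A, B, C, D) \<in> building.flags. A \<in> M 1 \<and> D \<in> M 4}"
  proof
    fix \<sigma> assume \<sigma>: "\<sigma> \<in> faces_through 1 4 U v"
    obtain A B C D where "(A, B, C, D) \<in> building.flags" "\<sigma> = {v, \<phi> A, \<phi> B, \<phi> C, \<phi> D}"
      "\<forall>j\<in>{1, 4}. [A, B, C, D] ! (j - 1) \<in> M j"
      using key[OF \<sigma>] by auto
    then show "\<sigma> \<in> ?\<chi> ` {(A, B, C, D) \<in> building.flags. A \<in> M 1 \<and> D \<in> M 4}"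
      by (intro image_eqI[of _ _ "(A, B, C, D)"]) auto
  qed
  then have "card (faces_through 1 4 U v) \<le> card {(A, B, C, D) \<in> building.flags. A \<in> M 1 \<and> D \<in> M 4}"
    by (rule surj_card_le[rotated]) (rule finite_subset[OF _ building.finite_flags], auto)
  then show "real (card (faces_through 1 4 U v)) \<le> 3 * s ^ 5 * ((d 1)\<^sup>2 + (d 4)\<^sup>2) + 2 * s ^ 13"
    using building.flags_point_hyperplane_bound[OF X M M s] card_M[of 1] card_M[of 4] by simp
  have "faces_through 2 3 U v \<subseteq> ?\<chi> ` {(A, B, C, D) \<in> building.flags. B \<in> M 2 \<and> C \<in> M 3}"
  proof
    fix \<sigma> assume \<sigma>: "\<sigma> \<in> faces_through 2 3 U v"
    obtain A B C D where "(A, B, C, D) \<in> building.flags" "\<sigma> = {v, \<phi> A, \<phi> B, \<phi> C, \<phi> D}"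
      "\<forall>j\<in>{2, 3}. [A, B, C, D] ! (j - 1) \<in> M j"
      using key[OF \<sigma>] by auto
    then show "\<sigma> \<in> ?\<chi> ` {(A, B, C, D) \<in> building.flags. B \<in> M 2 \<and> C \<in> M 3}"
      by (intro image_eqI[of _ _ "(A, B, C, D)"]) auto
  qed
  then have "card (faces_through 2 3 U v) \<le> card {(A, B, C, D) \<in> building.flags. B \<in> M 2 \<and> C \<in> M 3}"
    by (rule surj_card_le[rotated]) (rule finite_subset[OF _ building.finite_flags], auto)
  then show "real (card (faces_through 2 3 U v)) \<le> 4 * s * ((d 2)\<^sup>2 + (d 3)\<^sup>2) + 3 * s ^ 13"
    using building.flags_middle_bound[OF X M M Z s] card_M[of 2] card_M[of 3] by simp
qed

text \<open>One vertex per part turns the vertices in \<open>U\<close> into a set \<open>T\<close>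
  of at least three residues. The centre of a symmetric pattern in \<open>T\<close> supplies
  \<open>v\<close>, and the other two residues give the required arcs.\<close>

lemma heavy_face_cover:
  assumes \<sigma>: "\<sigma> \<in> faces complex 4" and card: "card (\<sigma> \<inter> U) \<ge> 3"
  shows "\<exists>v\<in>U. \<sigma> \<in> faces_through 1 4 U v \<union> faces_through 2 3 U v"
proof -
  have "\<exists>w. \<sigma> \<inter> V b = {w}" if "b < 5" for b using face_part[OF \<sigma> that] by metis
  then obtain c where c: "\<And>b. b < 5 \<Longrightarrow> \<sigma> \<inter> V b = {c b}" by metis
  define T where "T = {b. b < 5 \<and> c b \<in> U}"
  have "\<sigma> \<inter> U \<subseteq> c ` T"
  proof
    fix x assume x: "x \<in> \<sigma> \<inter> U"
    then have "x \<in> verts" using face_subset[OF \<sigma>] by blast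
    then obtain b where b: "b < 5" "x \<in> V b" by (rule part_of)
    then have "x = c b" using c[OF b(1)] x by blast
    then show "x \<in> c ` T" using b x by (auto simp: T_def)
  qed
  then have "card (\<sigma> \<inter> U) \<le> card T" by (rule surj_card_le[rotated]) (simp add: T_def)
  then have "card T \<ge> 3" using card by simp
  moreover have "T \<subseteq> {..<5}" by (auto simp: T_def)
  ultimately obtain a where aT: "a \<in> T"
    and T: "(a + 1) mod 5 \<in> T \<and> (a + 4) mod 5 \<in> T \<or> (a + 2) mod 5 \<in> T \<and> (a + 3) mod 5 \<in> T"
    using three_residues by blast
  have a: "a < 5" "c a \<in> U" using aT by (auto simp: T_def)
  have ca: "c a \<in> \<sigma>" "c a \<in> V a" using c[OF a(1)] by auto
  have nb: "\<exists>x\<in>\<sigma> \<inter> U. (c a, x) \<in> arcs j" if j: "j \<in> {1..<5}" "(a + j) mod 5 \<in> T" for j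
  proof
    let ?b = "(a + j) mod 5"
    have cb: "c ?b \<in> \<sigma>" "c ?b \<in> V ?b" "c ?b \<in> U" using c[of ?b] j(2) by (auto simp: T_def)
    show "c ?b \<in> \<sigma> \<inter> U" using cb by simp
    have "a \<noteq> ?b" using a j by (auto simp: mod_if split: if_splits)
    then have "c a \<noteq> c ?b" using part_unique[OF ca(2), of ?b] cb(2) a by auto
    then have "(c a, c ?b) \<in> all_arcs"
      using face_arcs[OF \<sigma> ca(1) cb(1)] by blast
    then show "(c a, c ?b) \<in> arcs j" using arc_index a ca cb j by auto
  qed
  have "\<sigma> \<in> faces_through 1 4 U (c a) \<union> faces_through 2 3 U (c a)"
    using T nb[of 1] nb[of 2] nb[of 3] nb[of 4] \<sigma> ca(1) by (auto simp: faces_through_def)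
  then show ?thesis using a(2) by blast
qed

section \<open>Summation over the small set\<close>

lemma sum_nbrs_square_le_5:
  assumes i: "i \<in> {1..<5}" and U: "U \<subseteq> verts" and n: "n > 0"
    and small: "real (card U) * real q ^ 6 \<le> real n"
  shows "(\<Sum>x\<in>U. (real (card (nbrs i U x)))\<^sup>2) \<le> 4960 * real q ^ (i * (5 - i)) * real (card U)"
proof -
  have i': "i = 1 \<or> i = 2 \<or> i = 3 \<or> i = 4" using i by auto
  have "i * (5 - i) \<le> 6" using i' by auto
  then have "real q ^ (i * (5 - i)) \<le> real q ^ 6"
    using q_ge_2 by (intro power_increasing) auto
  then have "real (card U) * real q ^ (i * (5 - i)) \<le> real (card U) * real q ^ 6"
    by (rule mult_left_mono) simp
  then have small': "real (card U) * real q ^ (i * (5 - i)) \<le> real n" using small by linarith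
  have "(\<Sum>x\<in>U. (real (card (nbrs i U x)))\<^sup>2) \<le> (\<Sum>x\<in>verts. (real (card (nbrs i U x)))\<^sup>2)"
    using U finite_verts by (intro sum_mono2) auto
  also have "\<dots> \<le> (4 * (1 + real 5) * (real (5 choose i))\<^sup>2 + 2 * real 5 * 4 ^ i) * real q ^ (i * (5 - i)) * real (card U)"
    using sum_nbrs_square_le[OF i U n small'] .
  \<comment> \<open>For \<open>k = 5\<close> the binomial coefficients are at most 10, and 4 * 6 *
    10^2 + 2 * 5 * 4^4 = 4960.\<close>
  also have "\<dots> \<le> 4960 * real q ^ (i * (5 - i)) * real (card U)"
  proof (intro mult_right_mono)
    have "5 choose i \<le> 10" using i' by (auto simp: eval_nat_numeral)
    then have "(real (5 choose i))\<^sup>2 \<le> 10\<^sup>2" by (intro power_mono) auto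
    moreover have "(4::real) ^ i \<le> 4 ^ 4" using i by (intro power_increasing) auto
    ultimately show "4 * (1 + real 5) * (real (5 choose i))\<^sup>2 + 2 * real 5 * 4 ^ i \<le> 4960" by simp
  qed auto
  finally show ?thesis .
qed

text \<open>A union bound over \<open>v\<close> in \<open>U\<close>. Both patterns balance at
  \<open>s ^ 13\<close>: \<open>s ^ 5\<close> meets squared degrees of total order
  \<open>s ^ 8\<close>, and \<open>s\<close> meets those of order \<open>s ^ 12\<close>. The
  constant is (6 + 8) * 4960 + 5.\<close>

theorem card_heavy_faces_le:
  assumes U: "U \<subseteq> verts" and small: "real (card U) * real q ^ 6 \<le> real n"
  shows "real (card {\<sigma> \<in> faces complex 4. card (\<sigma> \<inter> U) \<ge> 3}) \<le> 69445 * real q powr (13 / 2) * real (card U)"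
proof (cases "n = 0")
  \<comment> \<open>The spectral estimate divides by \<open>n\<close>; for \<open>n = 0\<close>
    there are no vertices at all.\<close>
  case True
  then have "verts = {}" using card_verts finite_verts by simp
  then have "U = {}" using U by blast
  then have E: "{\<sigma> \<in> faces complex 4. card (\<sigma> \<inter> U) \<ge> 3} = {}" by simp
  show ?thesis unfolding E by simp
next
  case False
  then have n: "n > 0" by simp
  have finU: "finite U" using U finite_verts finite_subset by blast
  define s where "s = sqrt (real q)"
  have s: "s > 0" "s\<^sup>2 = real q" using q_ge_2 by (auto simp: s_def)
  define d where "d i x = real (card (nbrs i U x))" for i x
  define c where "c = real (card U)"
  let ?F = "\<lambda>v. faces_through 1 4 U v \<union> faces_through 2 3 U v"
  have fin: "finite (?F v)" for v
    by (rule finite_subset[OF _ finite_faces]) (auto simp: faces_through_def)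
  have "card {\<sigma> \<in> faces complex 4. card (\<sigma> \<inter> U) \<ge> 3} \<le> card (\<Union>v\<in>U. ?F v)"
  proof (rule card_mono)
    show "{\<sigma> \<in> faces complex 4. card (\<sigma> \<inter> U) \<ge> 3} \<subseteq> (\<Union>v\<in>U. ?F v)"
    proof
      fix \<sigma> assume "\<sigma> \<in> {\<sigma> \<in> faces complex 4. card (\<sigma> \<inter> U) \<ge> 3}"
      then have "\<exists>v\<in>U. \<sigma> \<in> ?F v" using heavy_face_cover[of \<sigma> U] by blast
      then show "\<sigma> \<in> (\<Union>v\<in>U. ?F v)" by blast
    qed
  qed (rule finite_UN_I[OF finU fin])
  also have "\<dots> \<le> (\<Sum>v\<in>U. card (?F v))" by (rule card_UN_le[OF finU])
  finally have "real (card {\<sigma> \<in> faces complex 4. card (\<sigma> \<inter> U) \<ge> 3}) \<le> real (\<Sum>v\<in>U. card (?F v))"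
    using of_nat_le_iff by blast
  also have "\<dots> = (\<Sum>v\<in>U. real (card (?F v)))" by (rule of_nat_sum)
  also have "\<dots> \<le> (\<Sum>v\<in>U. 3 * s ^ 5 * ((d 1 v)\<^sup>2 + (d 4 v)\<^sup>2) + 4 * s * ((d 2 v)\<^sup>2 + (d 3 v)\<^sup>2) + 5 * s ^ 13)"
  proof (rule sum_mono)
    fix v assume "v \<in> U"
    then have v: "v \<in> verts" using U by blast
    have "real (card (?F v)) \<le> real (card (faces_through 1 4 U v) + card (faces_through 2 3 U v))"
      using card_Un_le of_nat_le_iff by blast
    then show "real (card (?F v)) \<le> 3 * s ^ 5 * ((d 1 v)\<^sup>2 + (d 4 v)\<^sup>2) + 4 * s * ((d 2 v)\<^sup>2 + (d 3 v)\<^sup>2) + 5 * s ^ 13"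
      using card_faces_through[OF v s, of U] by (simp add: d_def)
  qed
  also have "\<dots> = 3 * s ^ 5 * ((\<Sum>v\<in>U. (d 1 v)\<^sup>2) + (\<Sum>v\<in>U. (d 4 v)\<^sup>2))
      + 4 * s * ((\<Sum>v\<in>U. (d 2 v)\<^sup>2) + (\<Sum>v\<in>U. (d 3 v)\<^sup>2)) + 5 * s ^ 13 * c"
    by (simp add: sum.distrib c_def flip: sum_distrib_left)
  also have "\<dots> \<le> 3 * s ^ 5 * (4960 * s ^ 8 * c + 4960 * s ^ 8 * c)
      + 4 * s * (4960 * s ^ 12 * c + 4960 * s ^ 12 * c) + 5 * s ^ 13 * c"
  proof -
    have q: "real q ^ 4 = s ^ 8" "real q ^ 6 = s ^ 12" by (simp_all flip: s(2) power_mult)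
    have "(\<Sum>v\<in>U. (d 1 v)\<^sup>2) \<le> 4960 * s ^ 8 * c" "(\<Sum>v\<in>U. (d 4 v)\<^sup>2) \<le> 4960 * s ^ 8 * c"
      "(\<Sum>v\<in>U. (d 2 v)\<^sup>2) \<le> 4960 * s ^ 12 * c" "(\<Sum>v\<in>U. (d 3 v)\<^sup>2) \<le> 4960 * s ^ 12 * c"
      using sum_nbrs_square_le_5[OF _ U n small, of 1] sum_nbrs_square_le_5[OF _ U n small, of 2]
        sum_nbrs_square_le_5[OF _ U n small, of 3] sum_nbrs_square_le_5[OF _ U n small, of 4]
      by (simp_all add: d_def c_def q)
    then show ?thesis using s by (intro add_mono mult_left_mono) auto
  qed
  also have "\<dots> = 69445 * s ^ 13 * c" by (simp add: algebra_simps eval_nat_numeral)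
  also have "s ^ 13 = real q powr (13 / 2)"
  proof -
    have "s ^ 13 = (real q powr (1 / 2)) ^ 13" using s by (simp add: s_def powr_half_sqrt)
    also have "\<dots> = real q powr (13 / 2)" using q_ge_2 by (simp add: powr_power)
    finally show ?thesis .
  qed
  finally show ?thesis by (simp add: c_def)
qed

end

theorem corollary4p9:
  "\<exists>C::real. \<forall>(q::nat) (e::nat) (n::nat) (Fq::nat ring) (Fqe::nat ring) S V (\<delta>::real) U.
     ramanujan_clique_complex 5 q e n Fq Fqe S V \<longrightarrow>
     \<delta> < real q powr (- 25 / 4) \<longrightarrow>
     U \<subseteq> carrier (PGL 5 Fqe) \<longrightarrow>
     real (card U) \<le> \<delta> * real n \<longrightarrow>
     real (card {\<sigma> \<in> faces (cayley_clique_complex 5 (PGL 5 Fqe) S) 4. card (\<sigma> \<inter> U) \<ge> 3})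
       \<le> C * real q powr (13 / 2) * real (card U)"
proof (intro exI[of _ 69445] allI impI)
  fix q e n :: nat and Fq Fqe :: "nat ring" and S V \<delta> U
  assume X: "ramanujan_clique_complex 5 q e n Fq Fqe S V"
    and \<delta>: "\<delta> < real q powr (- 25 / 4)" and U: "U \<subseteq> carrier (PGL 5 Fqe)"
    and card: "real (card U) \<le> \<delta> * real n"
  interpret ramanujan_clique_complex 5 q e n Fq Fqe S V by (rule X)
  interpret ramanujan_clique_complex_5 q e n Fq Fqe S V ..
  have "real (card U) \<le> real q powr (- 25 / 4) * real n"
    using card mult_right_mono[of \<delta> "real q powr (- 25 / 4)" "real n"] \<delta> by linarith
  then have "real (card U) * real q ^ 6 \<le> real q powr (- 25 / 4) * real n * real q ^ 6"
    by (rule mult_right_mono) simp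
  \<comment> \<open>The exponent 6 is the largest value of i (5 - i), and -25/4 + 6 = -1/4 is
    negative.\<close>
  also have "\<dots> = real q powr (- 1 / 4) * real n"
  proof -
    have "real q powr (- 1 / 4) = real q powr (- 25 / 4 + 6)" by simp
    also have "\<dots> = real q powr (- 25 / 4) * real q ^ 6"
      using q_ge_2 by (subst powr_add) simp
    finally show ?thesis by simp
  qed
  also have "\<dots> \<le> 1 * real n"
    using q_ge_2 powr_mono[of "- 1 / 4" 0 "real q"] by (intro mult_right_mono) simp_all
  finally have "real (card U) * real q ^ 6 \<le> real n" by simp
  then show "real (card {\<sigma> \<in> faces (cayley_clique_complex 5 (PGL 5 Fqe) S) 4. card (\<sigma> \<inter> U) \<ge> 3})
      \<le> 69445 * real q powr (13 / 2) * real (card U)"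
    by (rule card_heavy_faces_le[OF U])
qed

end
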